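(* Let $\{X_\gamma\}_{\gamma\in\Gamma}$ be a family of strictly convex real Banach spaces such that $|\Gamma|\geq 2$ and such that, for every $\gamma\in\Gamma$, $\dim(X_\gamma)\geq 2$ and the set $Sm(X_\gamma)$ of smooth points of $X_\gamma$ is norm dense in the unit sphere $S_{X_\gamma}$. Then both $Z_0=\bigoplus^{c_0}_{\gamma\in\Gamma}X_\gamma$ and $Z_\infty=\bigoplus^{\ell_\infty}_{\gamma\in\Gamma}X_\gamma$ satisfy the Mazur--Ulam property.
   Context: All Banach spaces are real. $Z_\infty=\bigoplus^{\ell_\infty}_{\gamma\in\Gamma}X_\gamma$ is the space of all families $z=(z(\gamma))_{\gamma\in\Gamma}$ with $z(\gamma)\in X_\gamma$ and $\|z\|=\sup_\gamma\|z(\gamma)\|<\infty$; $Z_0=\bigoplus^{c_0}_{\gamma\in\Gamma}X_\gamma$ is the closed subspace of those $z$ such that $\{\gamma:\|z(\gamma)\|>\varepsilon\}$ is finite for every $\varepsilon>0$. A Banach space is strictly convex if every point of its unit sphere is an extreme point of its closed unit ball. A point $x\in S_X$ is a smooth point if there is a unique $f\in S_{X^*}$ with $f(x)=1$. A Banach space $Z$ satisfies the Mazur--Ulam property if for every Banach space $Y$, every surjective isometry $\Delta:S_Z\to S_Y$ between the unit spheres admits an extension to a surjective real-linear isometry from $Z$ onto $Y$. *)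

theory Defs
  imports "HOL-Analysis.Analysis"
begin

text \<open>A real Banach space X is represented as a closed linear subspace of an
ambient Banach space type, carrying the ambient norm.\<close>

definition banach_subspace :: "'a::banach set \<Rightarrow> bool" where
  "banach_subspace X \<longleftrightarrow> subspace X \<and> closed X"

definition strictly_convex_sp :: "'a::real_normed_vector set \<Rightarrow> bool" where
  "strictly_convex_sp X \<longleftrightarrow>
     (\<forall>x\<in>X. norm x = 1 \<longrightarrow> x extreme_point_of (X \<inter> cball 0 1))"

text \<open>Norm-one continuous linear functionals on X attaining the value 1 at x
(functionals are identified when they agree on X).\<close>
definition norming_functionals :: "'a::real_normed_vector set \<Rightarrow> 'a \<Rightarrow> ('a \<Rightarrow> real) set" where
  "norming_functionals X x =
     {f. (\<forall>y\<in>X. \<forall>z\<in>X. f (y + z) = f y + f z) \<and>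
         (\<forall>c. \<forall>y\<in>X. f (c *\<^sub>R y) = c * f y) \<and>
         (\<exists>B. \<forall>y\<in>X. \<bar>f y\<bar> \<le> B * norm y) \<and>
         (SUP y\<in>{y\<in>X. norm y \<le> 1}. \<bar>f y\<bar>) = 1 \<and>
         f x = 1}"

definition smooth_point :: "'a::real_normed_vector set \<Rightarrow> 'a \<Rightarrow> bool" where
  "smooth_point X x \<longleftrightarrow> x \<in> X \<and> norm x = 1 \<and>
     (\<exists>f\<in>norming_functionals X x. \<forall>g\<in>norming_functionals X x. \<forall>y\<in>X. g y = f y)"

definition smooth_points :: "'a::real_normed_vector set \<Rightarrow> 'a set" where
  "smooth_points X = {x. smooth_point X x}"

text \<open>The index set Gamma is the universe of the index type 'i.\<close>

definition sup_norm :: "('i \<Rightarrow> 'a::real_normed_vector) \<Rightarrow> real" where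
  "sup_norm z = (SUP \<gamma>. norm (z \<gamma>))"

definition linf_sum :: "('i \<Rightarrow> 'a::real_normed_vector set) \<Rightarrow> ('i \<Rightarrow> 'a) set" where
  "linf_sum X = {z. (\<forall>\<gamma>. z \<gamma> \<in> X \<gamma>) \<and> bdd_above (range (\<lambda>\<gamma>. norm (z \<gamma>)))}"

definition c0_sum :: "('i \<Rightarrow> 'a::real_normed_vector set) \<Rightarrow> ('i \<Rightarrow> 'a) set" where
  "c0_sum X = {z \<in> linf_sum X. \<forall>\<epsilon>>0. finite {\<gamma>. norm (z \<gamma>) > \<epsilon>}}"

definition MU_extends_to :: "('i \<Rightarrow> 'a::real_normed_vector) set \<Rightarrow> 'b::real_normed_vector set \<Rightarrow> bool" where
  "MU_extends_to Z Y \<longleftrightarrow>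
    (\<forall>\<Delta>. \<Delta> ` {z\<in>Z. sup_norm z = 1} = {y\<in>Y. norm y = 1} \<and>
         (\<forall>x\<in>{z\<in>Z. sup_norm z = 1}. \<forall>z\<in>{z\<in>Z. sup_norm z = 1}.
             dist (\<Delta> x) (\<Delta> z) = sup_norm (\<lambda>\<gamma>. x \<gamma> - z \<gamma>))
      \<longrightarrow> (\<exists>T. (\<forall>x\<in>Z. \<forall>z\<in>Z. T (\<lambda>\<gamma>. x \<gamma> + z \<gamma>) = T x + T z) \<and>
               (\<forall>c. \<forall>x\<in>Z. T (\<lambda>\<gamma>. c *\<^sub>R x \<gamma>) = c *\<^sub>R T x) \<and>
               T ` Z = Y \<and>
               (\<forall>x\<in>Z. \<forall>z\<in>Z. dist (T x) (T z) = sup_norm (\<lambda>\<gamma>. x \<gamma> - z \<gamma>)) \<and>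
               (\<forall>x\<in>{z\<in>Z. sup_norm z = 1}. T x = \<Delta> x)))"

text \<open>Mazur--Ulam property: extension property for every Banach space Y
(every closed subspace of every Banach space type 'b).\<close>
definition mazur_ulam_property :: "('i \<Rightarrow> 'a::real_normed_vector) set \<Rightarrow> 'b::banach itself \<Rightarrow> bool" where
  "mazur_ulam_property Z _ \<longleftrightarrow> (\<forall>Y::'b set. banach_subspace Y \<longrightarrow> MU_extends_to Z Y)"

end

theory Submission
  imports Defs
begin

text \<open>For a unit vector \<open>u\<close> of \<open>X \<gamma>\<close>, the face of all \<open>z\<close> in the sphere with \<open>z(\<gamma>) = u\<close> is, by strict
  convexity, the set of all \<open>y\<close> with \<open>\<parallel>y + z\<parallel> = 2\<close>, for each of its inner points \<open>z\<close>. Its image under the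
  isometry \<open>\<Delta>\<close> is therefore also such a star, of the point \<open>-\<Delta>(-z)\<close>; as these points are dense in
  the image, the image is convex and supports a functional \<open>f\<close> of norm one by Hahn--Banach.

  If \<open>u\<close> is smooth with derivative \<open>p\<close> of the norm, then \<open>f(\<Delta> z) = p(z(\<gamma>))\<close>. When another coordinate
  of \<open>z\<close> has norm one, the convexity of the image of the face of that coordinate and the
  uniqueness of metric interpolation in \<open>X \<gamma>\<close> bound \<open>f(\<Delta> z)\<close> by difference quotients of the norm at
  \<open>\<plusminus>u\<close>. This case implies that \<open>\<Delta>\<close> is affine on every face, from which the case where only
  \<open>z(\<gamma>)\<close> has norm one follows, and the rest is density.

  These functionals separate the points of \<open>Y\<close>, and they are additive on the positively
  homogeneous extension of \<open>\<Delta>\<close>, which is therefore linear.\<close>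


section \<open>Sublinear functionals and the Hahn--Banach theorem\<close>

definition sublinear :: "('v::real_vector \<Rightarrow> real) \<Rightarrow> bool" where
  "sublinear p \<longleftrightarrow> (\<forall>x y. p (x + y) \<le> p x + p y) \<and> (\<forall>c x. 0 \<le> c \<longrightarrow> p (c *\<^sub>R x) = c * p x)"

lemma sublinear_add: "sublinear p \<Longrightarrow> p (x + y) \<le> p x + p y"
  and sublinear_scale: "sublinear p \<Longrightarrow> 0 \<le> c \<Longrightarrow> p (c *\<^sub>R x) = c * p x"
  by (simp_all add: sublinear_def)

lemma sublinear_zero: "sublinear p \<Longrightarrow> p 0 = 0"
  using sublinear_scale[of p 0 0] by simp

lemma sublinear_neg: "sublinear p \<Longrightarrow> - p (- x) \<le> p x"
  using sublinear_add[of p x "- x"] sublinear_zero[of p] by simp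

lemma sublinearI:
  assumes add: "\<And>x y. p (x + y) \<le> p x + p y" and zero: "p 0 = 0"
    and sc: "\<And>c x. 0 < c \<Longrightarrow> p (c *\<^sub>R x) \<le> c * p x"
  shows "sublinear p"
proof -
  have "p (c *\<^sub>R x) = c * p x" if "0 \<le> c" for c x
  proof (cases "c = 0")
    case False
    with that have c: "0 < c" by simp
    have "p (inverse c *\<^sub>R (c *\<^sub>R x)) \<le> inverse c * p (c *\<^sub>R x)"
      using c by (intro sc) simp
    then have "c * p x \<le> p (c *\<^sub>R x)"
      using c by (simp add: field_simps)
    then show ?thesis using sc[OF c, of x] by simp
  qed (simp add: zero)
  then show ?thesis by (simp add: sublinear_def add)
qed

lemma sublinear_norm: "sublinear norm"
  by (rule sublinearI) (auto simp: norm_triangle_ineq)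

text \<open>The largest sublinear functional below \<open>p\<close> that is at most \<open>-s\<close> at \<open>-v\<close> for all
  \<open>(v, s)\<close> in the convex cone \<open>K\<close>.\<close>
definition cone_minorant :: "('v::real_vector \<Rightarrow> real) \<Rightarrow> ('v \<times> real) set \<Rightarrow> 'v \<Rightarrow> real" where
  "cone_minorant p K y = (INF w\<in>K. p (y + fst w) - snd w)"

text \<open>By \<open>dom\<close> and subadditivity every term of the infimum is at least
  \<open>- p (- y)\<close>, so it is finite. Closure of \<open>K\<close> under addition gives
  subadditivity, closure under scaling gives homogeneity.\<close>

lemma cone_minorant:
  assumes p: "sublinear p" and K: "convex_cone K"
    and dom: "\<forall>w\<in>K. snd w \<le> p (fst w)"
  shows "sublinear (cone_minorant p K)"
    and "w \<in> K \<Longrightarrow> cone_minorant p K y \<le> p (y + fst w) - snd w"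
    and "cone_minorant p K y \<le> p y"
    and "w \<in> K \<Longrightarrow> cone_minorant p K (- fst w) \<le> - snd w"
proof -
  have lower: "- p (- y) \<le> p (y + fst w) - snd w" if "w \<in> K" for w y
    using sublinear_add[OF p, of "y + fst w" "- y"] bspec[OF dom that] by simp
  have bdd: "bdd_below ((\<lambda>w. p (y + fst w) - snd w) ` K)" for y
    using lower by (auto intro!: bdd_belowI2)
  show le: "cone_minorant p K y \<le> p (y + fst w) - snd w" if "w \<in> K" for w y
    unfolding cone_minorant_def by (rule cINF_lower[OF bdd that])
  have ge: "m \<le> cone_minorant p K y" if "\<And>w. w \<in> K \<Longrightarrow> m \<le> p (y + fst w) - snd w" for m y
    unfolding cone_minorant_def using convex_cone_nonempty[OF K] that by (intro cINF_greatest) auto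
  show lep: "cone_minorant p K y \<le> p y" for y
    using le[OF convex_cone_contains_0[OF K]] by simp
  show "cone_minorant p K (- fst w) \<le> - snd w" if "w \<in> K" for w
    using le[OF that, of "- fst w"] sublinear_zero[OF p] by simp
  show "sublinear (cone_minorant p K)"
  proof (rule sublinearI)
    fix x y
    have "cone_minorant p K (x + y) - (p (y + fst w') - snd w') \<le> p (x + fst w) - snd w"
      if "w \<in> K" "w' \<in> K" for w w'
      using le[OF convex_cone_add[OF K that], of "x + y"] sublinear_add[OF p, of "x + fst w" "y + fst w'"]
      by (simp add: algebra_simps)
    then have "cone_minorant p K (x + y) - (p (y + fst w') - snd w') \<le> cone_minorant p K x"
      if "w' \<in> K" for w' using that by (intro ge)
    then have "cone_minorant p K (x + y) - cone_minorant p K x \<le> p (y + fst w') - snd w'"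
      if "w' \<in> K" for w' using that by (simp add: algebra_simps)
    then have "cone_minorant p K (x + y) - cone_minorant p K x \<le> cone_minorant p K y"
      by (intro ge)
    then show "cone_minorant p K (x + y) \<le> cone_minorant p K x + cone_minorant p K y" by simp
  next
    have "0 \<le> cone_minorant p K 0"
      using lower[of _ 0] sublinear_zero[OF p] by (intro ge) simp
    then show "cone_minorant p K 0 = 0"
      using lep[of 0] sublinear_zero[OF p] by simp
  next
    fix c :: real and x assume c: "0 < c"
    have "inverse c * cone_minorant p K (c *\<^sub>R x) \<le> p (x + fst w) - snd w" if "w \<in> K" for w
    proof -
      have "cone_minorant p K (c *\<^sub>R x) \<le> p (c *\<^sub>R (x + fst w)) - c * snd w"
        using le[OF convex_cone_scaleR[OF K less_imp_le[OF c] that], of "c *\<^sub>R x"] by (simp add: algebra_simps)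
      also have "\<dots> = c * (p (x + fst w) - snd w)"
        using c sublinear_scale[OF p, of c "x + fst w"] by (simp add: right_diff_distrib)
      finally show ?thesis using c by (simp add: field_simps)
    qed
    then have "inverse c * cone_minorant p K (c *\<^sub>R x) \<le> cone_minorant p K x" by (rule ge)
    then show "cone_minorant p K (c *\<^sub>R x) \<le> c * cone_minorant p K x"
      using c by (simp add: field_simps)
  qed
qed

text \<open>The cone is the single ray through \<open>(x, p x)\<close>, on which \<open>dom\<close>
  holds with equality.\<close>

lemma sublinear_directional_minorant:
  assumes p: "sublinear p"
  obtains q where "sublinear q" "\<And>y. q y \<le> p y" "q (- x) \<le> - p x"
proof -
  define K where "K = conic hull {(x, p x)}"
  have K: "convex_cone K"
    by (simp add: K_def convex_cone_def convex_conic_hull conic_conic_hull conic_hull_eq_empty)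
  have dom: "\<forall>w\<in>K. snd w \<le> p (fst w)"
    using sublinear_scale[OF p] by (auto simp: K_def conic_hull_explicit)
  have mem: "(x, p x) \<in> K" by (simp add: K_def hull_inc)
  note cm = cone_minorant[OF p K dom]
  have "cone_minorant p K (- x) \<le> - p x" using cm(4)[OF mem] by simp
  then show thesis using that cm(1,3) by blast
qed

lemma minimal_sublinear_exists:
  assumes p: "sublinear p"
  obtains q where "sublinear q" "\<And>x. q x \<le> p x"
    "\<And>r. sublinear r \<Longrightarrow> (\<And>x. r x \<le> q x) \<Longrightarrow> r = q"
proof -
  define A where "A = {q. sublinear q \<and> (\<forall>x. q x \<le> p x)}"
  \<comment> \<open>The order is reversed, so Zorn's maximal element is a minimal functional and
    upper bounds of chains are pointwise infima.\<close>
  define P where "P = (\<lambda>(q :: 'a \<Rightarrow> real) r. \<forall>x. r x \<le> q x)"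
  have "\<exists>m\<in>A. \<forall>a\<in>A. P m a \<longrightarrow> a = m"
  proof (rule predicate_Zorn)
    show "partial_order_on A (relation_of P A)"
      by (rule partial_order_on_relation_ofI) (auto simp: P_def intro: order_trans, blast intro: ext order_antisym)
  next
    fix C assume C: "C \<in> Chains (relation_of P A)"
    then have CA: "C \<subseteq> A" and tot: "\<And>q r. q \<in> C \<Longrightarrow> r \<in> C \<Longrightarrow> P q r \<or> P r q"
      by (auto simp: Chains_def relation_of_def)
    show "\<exists>u\<in>A. \<forall>a\<in>C. P a u"
    proof (cases "C = {}")
      case True
      then show ?thesis using p by (auto simp: A_def)
    next
      case False
      define u where "u x = (INF q\<in>C. q x)" for x
      have sub: "sublinear q" "q x \<le> p x" if "q \<in> C" for q x using CA that by (auto simp: A_def)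
      have lower: "- p (- x) \<le> q x" if "q \<in> C" for q x
        using sublinear_neg[OF sub(1)[OF that], of x] sub(2)[OF that, of "- x"] by simp
      have le: "u x \<le> q x" if "q \<in> C" for q x
        unfolding u_def using lower that by (intro cINF_lower) (auto intro!: bdd_belowI2)
      have ge: "m \<le> u x" if "\<And>q. q \<in> C \<Longrightarrow> m \<le> q x" for m x
        unfolding u_def using False that by (intro cINF_greatest)
      have "sublinear u"
      proof (rule sublinearI)
        fix x y
        \<comment> \<open>Of two members of a chain the smaller lies below both, so one
          \<open>s\<close> serves at \<open>x\<close> and at \<open>y\<close>.\<close>
        have *: "u (x + y) \<le> q x + r y" if qr: "q \<in> C" "r \<in> C" for q r
        proof -
          from tot[OF qr] obtain s where "s \<in> C" "s x \<le> q x" "s y \<le> r y"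
            using qr by (auto simp: P_def)
          then show ?thesis using le[of s "x + y"] sublinear_add[OF sub(1), of s x y] by linarith
        qed
        have "u (x + y) - r y \<le> u x" if "r \<in> C" for r
          using *[OF _ that] by (intro ge) (simp add: algebra_simps)
        then have "u (x + y) - u x \<le> u y" by (intro ge) (simp add: algebra_simps)
        then show "u (x + y) \<le> u x + u y" by simp
      next
        have "u 0 = (INF q\<in>C. 0)" unfolding u_def
          using sub(1) by (intro INF_cong) (auto simp: sublinear_zero)
        then show "u 0 = 0" using False by simp
      next
        fix c :: real and x assume c: "0 < c"
        have "inverse c * u (c *\<^sub>R x) \<le> q x" if "q \<in> C" for q
          using le[OF that, of "c *\<^sub>R x"] sublinear_scale[OF sub(1)[OF that], of c x] c
          by (simp add: field_simps)
        then have "inverse c * u (c *\<^sub>R x) \<le> u x" by (rule ge)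
        then show "u (c *\<^sub>R x) \<le> c * u x" using c by (simp add: field_simps)
      qed
      moreover have "u x \<le> p x" for x using False le sub(2) by (meson all_not_in_conv order_trans)
      ultimately show ?thesis using le by (auto simp: A_def P_def)
    qed
  qed
  then obtain m where m: "m \<in> A" "\<And>a. a \<in> A \<Longrightarrow> P m a \<Longrightarrow> a = m" by blast
  show thesis
  proof (rule that)
    show "sublinear m" "m x \<le> p x" for x using m(1) by (auto simp: A_def)
    show "r = m" if "sublinear r" "\<And>x. r x \<le> m x" for r
      using that m(1) by (intro m(2)) (auto simp: A_def P_def intro: order_trans)
  qed
qed

text \<open>Oddness turns subadditivity at \<open>- x\<close> and \<open>- y\<close> into the
  reverse inequality.\<close>

lemma sublinear_additive_if_odd:
  assumes p: "sublinear p" and odd: "p (- x) = - p x" "p (- y) = - p y"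
  shows "p (x + y) = p x + p y"
proof -
  have "p (- x - y) \<le> p (- x) + p (- y)" using sublinear_add[OF p, of "- x" "- y"] by simp
  moreover have "- p (- x - y) \<le> p (x + y)" using sublinear_neg[OF p, of "x + y"] by simp
  ultimately show ?thesis using sublinear_add[OF p, of x y] odd by linarith
qed

lemma sublinear_scale_if_odd:
  assumes p: "sublinear p" and odd: "p (- x) = - p x"
  shows "p (c *\<^sub>R x) = c * p x"
proof (cases "0 \<le> c")
  case False
  then show ?thesis using sublinear_scale[OF p, of "- c" "- x"] odd by simp
qed (simp add: sublinear_scale[OF p])

text \<open>A minimal sublinear functional below \<open>p\<close> coincides with all its directional minorants,
  which forces it to be odd.\<close>
theorem linear_minorant_exists:
  assumes p: "sublinear p"
  obtains f where "linear f" "\<And>x. f x \<le> p x"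
proof -
  obtain q where q: "sublinear q" "\<And>x. q x \<le> p x"
    and min: "\<And>r. sublinear r \<Longrightarrow> (\<And>x. r x \<le> q x) \<Longrightarrow> r = q"
    using minimal_sublinear_exists[OF p] by blast
  have odd: "q (- x) = - q x" for x
  proof -
    obtain r where "sublinear r" "\<And>y. r y \<le> q y" "r (- x) \<le> - q x"
      using sublinear_directional_minorant[OF q(1)] by blast
    with min have "q (- x) \<le> - q x" by metis
    then show ?thesis using sublinear_neg[OF q(1), of x] by simp
  qed
  have "linear q"
    by (intro linearI) (simp_all add: sublinear_additive_if_odd sublinear_scale_if_odd q(1) odd)
  then show thesis using that q(2) by blast
qed

text \<open>A linear \<open>f\<close> below the directional minorant has
  \<open>f (- x) \<le> - p x\<close>, hence \<open>f x \<ge> p x\<close>.\<close>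

corollary linear_minorant_touching:
  assumes p: "sublinear p"
  obtains f where "linear f" "\<And>y. f y \<le> p y" "f x = p x"
proof -
  obtain q where q: "sublinear q" "\<And>y. q y \<le> p y" "q (- x) \<le> - p x"
    using sublinear_directional_minorant[OF p] by blast
  obtain f where f: "linear f" "\<And>y. f y \<le> q y" using linear_minorant_exists[OF q(1)] by blast
  have "f x = p x"
    using linear_neg[OF f(1), of x] f(2)[of x] f(2)[of "- x"] q(2)[of x] q(3) by linarith
  then show thesis using that f q(2) order_trans by blast
qed

section \<open>Support functions of convex subsets of the unit sphere\<close>

text \<open>For a convex subset \<open>C\<close> of the unit sphere, the supremum over all functionals of norm one
  that are constantly one on \<open>C\<close>; for a singleton it is the directional derivative of the norm.\<close>
definition face_gauge :: "'v::real_normed_vector set \<Rightarrow> 'v \<Rightarrow> real" where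
  "face_gauge C = cone_minorant norm (conic hull (C \<times> {1}))"

text \<open>Convexity of \<open>C\<close> makes its conic hull a convex cone; as \<open>C\<close>
  lies in the unit sphere, the norm of \<open>t *\<^sub>R c\<close> is exactly \<open>t\<close>, so
  \<open>cone_minorant\<close> applies.\<close>

lemma
  assumes C: "convex C" "C \<noteq> {}" "\<And>c. c \<in> C \<Longrightarrow> norm c = 1"
  shows sublinear_face_gauge: "sublinear (face_gauge C)"
    and face_gauge_upper: "c \<in> C \<Longrightarrow> 0 \<le> t \<Longrightarrow> face_gauge C y \<le> norm (y + t *\<^sub>R c) - t"
    and face_gauge_le_norm: "face_gauge C y \<le> norm y"
    and face_gauge_neg: "c \<in> C \<Longrightarrow> face_gauge C (- c) \<le> - 1"
proof -
  let ?K = "conic hull (C \<times> {1})"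
  have K: "convex_cone ?K"
    using C by (simp add: convex_cone_def convex_conic_hull conic_conic_hull conic_hull_eq_empty convex_Times)
  have mem: "(t *\<^sub>R c, t) \<in> ?K" if "c \<in> C" "0 \<le> t" for c t
    using that by (auto simp: conic_hull_explicit intro!: exI[of _ t])
  have dom: "\<forall>w\<in>?K. snd w \<le> norm (fst w)"
    using C(3) by (auto simp: conic_hull_explicit)
  note cm = cone_minorant[OF sublinear_norm K dom, folded face_gauge_def]
  show "sublinear (face_gauge C)" by (rule cm(1))
  show "face_gauge C y \<le> norm y" by (rule cm(3))
  show "face_gauge C y \<le> norm (y + t *\<^sub>R c) - t" if "c \<in> C" "0 \<le> t"
    using cm(2)[OF mem[OF that], of y] by simp
  show "face_gauge C (- c) \<le> - 1" if "c \<in> C"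
    using cm(4)[OF mem[OF that, of 1]] by simp
qed

text \<open>\<open>face_gauge_neg\<close> forces \<open>f c \<ge> 1\<close>, and the norm bound
  forces \<open>f c \<le> 1\<close>.\<close>

lemma functional_one_on_convex:
  assumes "convex C" "C \<noteq> {}" "\<And>c. c \<in> C \<Longrightarrow> norm c = 1"
  obtains f where "linear f" "\<And>y. f y \<le> norm y" "\<And>c. c \<in> C \<Longrightarrow> f c = 1"
proof -
  obtain f where f: "linear f" "\<And>y. f y \<le> face_gauge C y"
    using linear_minorant_exists[OF sublinear_face_gauge[OF assms]] by blast
  have le: "f y \<le> norm y" for y using f(2) face_gauge_le_norm[OF assms] order_trans by blast
  have "f c = 1" if "c \<in> C" for c
    using f(2)[of "- c"] face_gauge_neg[OF assms that] linear_neg[OF f(1), of c] le[of c]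
      assms(3)[OF that] by simp
  then show thesis using that f(1) le by blast
qed

abbreviation norm_deriv :: "'v::real_normed_vector \<Rightarrow> 'v \<Rightarrow> real" where
  "norm_deriv u \<equiv> face_gauge {u}"

lemma
  assumes u: "norm u = 1"
  shows sublinear_norm_deriv: "sublinear (norm_deriv u)"
    and norm_deriv_upper: "0 \<le> t \<Longrightarrow> norm_deriv u y \<le> norm (y + t *\<^sub>R u) - t"
    and norm_deriv_le_norm: "norm_deriv u y \<le> norm y"
    and norm_deriv_neg: "norm_deriv u (- u) \<le> - 1"
  using u sublinear_face_gauge[of "{u}"] face_gauge_upper[of "{u}" u t y]
    face_gauge_le_norm[of "{u}" y] face_gauge_neg[of "{u}" u] by auto

text \<open>\<open>norm (y + t *\<^sub>R u) - t\<close> does not increase with \<open>t\<close>, so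
  a lower bound for large \<open>t\<close> bounds the whole infimum.\<close>

lemma norm_deriv_eqI_ge:
  assumes "\<And>t. 1 < t \<Longrightarrow> m \<le> norm (y + t *\<^sub>R u) - t" and u: "norm u = 1"
  shows "m \<le> norm_deriv u y"
proof -
  have "m \<le> norm (y + t *\<^sub>R u) - t" if "0 \<le> t" for t
  proof -
    have "norm (y + (t + 2) *\<^sub>R u) \<le> norm (y + t *\<^sub>R u) + norm (2 *\<^sub>R u)"
      by (rule order_trans[OF _ norm_triangle_ineq]) (simp add: algebra_simps)
    then show ?thesis using assms(1)[of "t + 2"] that u by simp
  qed
  then show ?thesis
    unfolding face_gauge_def cone_minorant_def by (intro cINF_greatest) (auto simp: conic_hull_explicit)
qed

lemma norm_deriv_self: "norm u = 1 \<Longrightarrow> norm_deriv u u = 1"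
  using norm_deriv_le_norm[of u u] norm_deriv_neg[of u]
    sublinear_neg[OF sublinear_norm_deriv, of u u] by simp

lemma norm_deriv_uminus:
  assumes u: "norm u = 1"
  shows "norm_deriv (- u) y = norm_deriv u (- y)"
proof -
  have le: "norm_deriv (- v) z \<le> norm_deriv v (- z)" if "norm v = 1" for v z :: 'a
  proof (rule norm_deriv_eqI_ge)
    fix t :: real assume "1 < t"
    then have "norm_deriv (- v) z \<le> norm (z + t *\<^sub>R (- v)) - t"
      using that by (intro norm_deriv_upper) auto
    also have "norm (z + t *\<^sub>R (- v)) = norm (- z + t *\<^sub>R v)"
      using norm_minus_commute[of z "t *\<^sub>R v"] by simp
    finally show "norm_deriv (- v) z \<le> norm (- z + t *\<^sub>R v) - t" .
  qed fact
  show ?thesis using le[of u y] le[of "- u" "- y"] u by simp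
qed

lemma norm_deriv_lipschitz:
  assumes "norm u = 1"
  shows "norm_deriv u x - norm_deriv u y \<le> norm (x - y)"
  using sublinear_add[OF sublinear_norm_deriv[OF assms], of "x - y" y]
    norm_deriv_le_norm[OF assms, of "x - y"] by simp

text \<open>Links the derivative of the norm to the definition of smoothness: such an
  \<open>f\<close> is bounded by the norm and takes the value 1 at \<open>u\<close>.\<close>

lemma norm_deriv_minorant_norming:
  assumes u: "u \<in> X" "norm u = 1"
    and f: "linear f" "\<And>y. f y \<le> norm_deriv u y"
  shows "f \<in> norming_functionals X u"
proof -
  have le: "f y \<le> norm y" for y using f(2) norm_deriv_le_norm[OF u(2)] order_trans by blast
  have abs: "\<bar>f y\<bar> \<le> norm y" for y using le[of y] le[of "- y"] linear_neg[OF f(1), of y] by simp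
  have fu: "f u = 1"
    using f(2)[of "- u"] norm_deriv_neg[OF u(2)] linear_neg[OF f(1), of u] le[of u] u(2) by simp
  have "(SUP y\<in>{y\<in>X. norm y \<le> 1}. \<bar>f y\<bar>) = 1"
  proof (rule cSup_eq_maximum)
    show "1 \<in> (\<lambda>y. \<bar>f y\<bar>) ` {y \<in> X. norm y \<le> 1}" using u fu by force
    show "x \<le> 1" if "x \<in> (\<lambda>y. \<bar>f y\<bar>) ` {y \<in> X. norm y \<le> 1}" for x
      using that abs order_trans by blast
  qed
  moreover have "\<exists>B. \<forall>y\<in>X. \<bar>f y\<bar> \<le> B * norm y" using abs by (intro exI[of _ 1]) simp
  ultimately show ?thesis
    using fu linear_add[OF f(1)] linear_scale[OF f(1)] by (simp add: norming_functionals_def)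
qed

text \<open>One linear minorant touches the derivative at \<open>a\<close>, another at
  \<open>- a\<close>. Both are norming at \<open>u\<close>, so smoothness identifies them on
  \<open>X\<close>.\<close>

lemma norm_deriv_odd_if_smooth:
  assumes "smooth_point X u" and X: "a \<in> X" "- a \<in> X"
  shows "norm_deriv u (- a) = - norm_deriv u a"
proof -
  from assms(1) obtain h where u: "u \<in> X" "norm u = 1"
    and h: "\<And>g y. g \<in> norming_functionals X u \<Longrightarrow> y \<in> X \<Longrightarrow> g y = h y"
    unfolding smooth_point_def by blast
  obtain f where f: "linear f" "\<And>y. f y \<le> norm_deriv u y" "f a = norm_deriv u a"
    using linear_minorant_touching[OF sublinear_norm_deriv[OF u(2)]] by blast
  obtain g where g: "linear g" "\<And>y. g y \<le> norm_deriv u y" "g (- a) = norm_deriv u (- a)"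
    using linear_minorant_touching[OF sublinear_norm_deriv[OF u(2)]] by blast
  have "f (- a) = g (- a)"
    using h[OF norm_deriv_minorant_norming[OF u f(1,2)] X(2)]
      h[OF norm_deriv_minorant_norming[OF u g(1,2)] X(2)] by simp
  then show ?thesis using f g linear_neg[OF f(1), of a] by simp
qed

section \<open>Strict convexity\<close>

text \<open>The points with weights \<open>l\<close> and \<open>1 - l\<close> add up to
  \<open>b + y\<close>, of norm 2, while each has norm at most 1.\<close>

lemma norm_segment_eq_1:
  fixes b y :: "'v::real_normed_vector"
  assumes "norm b = 1" "norm y = 1" "norm (b + y) = 2" "0 \<le> l" "l \<le> 1"
  shows "norm (l *\<^sub>R b + (1 - l) *\<^sub>R y) = 1"
proof -
  have le: "norm (l *\<^sub>R b + (1 - l) *\<^sub>R y) \<le> 1" if "0 \<le> l" "l \<le> 1" for l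
    using norm_triangle_ineq[of "l *\<^sub>R b" "(1 - l) *\<^sub>R y"] that assms by simp
  have "b + y = (l *\<^sub>R b + (1 - l) *\<^sub>R y) + ((1 - l) *\<^sub>R b + (1 - (1 - l)) *\<^sub>R y)"
    by (simp add: algebra_simps)
  then have "2 \<le> norm (l *\<^sub>R b + (1 - l) *\<^sub>R y) + norm ((1 - l) *\<^sub>R b + (1 - (1 - l)) *\<^sub>R y)"
    using norm_triangle_ineq assms(3) by metis
  then show ?thesis using le[of l] le[of "1 - l"] assms by simp
qed

text \<open>Otherwise the combination would be a norm-one point inside an open segment of the ball,
  hence not extreme.\<close>

lemma strictly_convex_sp_eqI:
  assumes sc: "strictly_convex_sp X" and X: "subspace X" and ab: "a \<in> X" "b \<in> X"
    and n: "norm a \<le> 1" "norm b \<le> 1" and l: "0 < l" "l < 1"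
    and eq: "norm (l *\<^sub>R a + (1 - l) *\<^sub>R b) = 1"
  shows "a = b"
proof (rule ccontr)
  assume ne: "a \<noteq> b"
  let ?c = "l *\<^sub>R a + (1 - l) *\<^sub>R b"
  have "?c \<in> X" using X ab by (simp add: subspace_add subspace_scale)
  with sc eq have "?c extreme_point_of (X \<inter> cball 0 1)" by (simp add: strictly_convex_sp_def)
  then have "?c \<notin> open_segment b a" using ab n by (auto simp: extreme_point_of_def)
  then show False using ne l by (auto simp: in_segment algebra_simps)
qed

lemma strictly_convex_sp_add_eq_2:
  assumes "strictly_convex_sp X" "subspace X" "a \<in> X" "b \<in> X"
    and "norm a \<le> 1" "norm b \<le> 1" "norm (a + b) = 2"
  shows "a = b"
proof (rule strictly_convex_sp_eqI[OF assms(1-6), of "1/2"])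
  have "(1/2) *\<^sub>R a + (1 - 1/2) *\<^sub>R b = (1/2) *\<^sub>R (a + b)" by (simp add: algebra_simps)
  then show "norm ((1/2) *\<^sub>R a + (1 - 1/2) *\<^sub>R b) = 1" using assms(7) by simp
qed auto

text \<open>Uniqueness of metric interpolation: a point within these two distances of
  \<open>a\<close> and \<open>b\<close> must lie on the segment.\<close>

lemma strictly_convex_sp_between:
  assumes sc: "strictly_convex_sp X" and X: "subspace X" and abc: "a \<in> X" "b \<in> X" "c \<in> X"
    and l: "0 < l" "l < 1"
    and n: "norm (c - a) \<le> (1 - l) * norm (a - b)" "norm (c - b) \<le> l * norm (a - b)"
  shows "c = l *\<^sub>R a + (1 - l) *\<^sub>R b"
proof (cases "a = b")
  case True
  then show ?thesis using n by (simp add: algebra_simps)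
next
  case False
  define r where "r = norm (a - b)"
  have r: "0 < r" using False by (simp add: r_def)
  \<comment> \<open>\<open>p\<close> and \<open>q\<close> rescale the two pieces
    \<open>c - b\<close> and \<open>a - c\<close> into the unit ball; their combination with weight
    \<open>l\<close> is the unit vector along \<open>a - b\<close>, so they coincide.\<close>
  define p where "p = (1 / (l * r)) *\<^sub>R (c - b)"
  define q where "q = (1 / ((1 - l) * r)) *\<^sub>R (a - c)"
  have "p = q"
  proof (rule strictly_convex_sp_eqI[OF sc X _ _ _ _ l])
    show "p \<in> X" "q \<in> X" using X abc by (simp_all add: p_def q_def subspace_diff subspace_scale)
    show "norm p \<le> 1" "norm q \<le> 1"
      using n l r by (simp_all add: p_def q_def r_def[symmetric] norm_minus_commute[of a c])
    have "l *\<^sub>R p + (1 - l) *\<^sub>R q = (1 / r) *\<^sub>R (a - b)"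
      using l r unfolding p_def q_def scaleR_scaleR
      by (simp add: scaleR_add_right[symmetric])
    then show "norm (l *\<^sub>R p + (1 - l) *\<^sub>R q) = 1" using r by (simp add: r_def)
  qed
  then have "(l * r * (1 - l)) *\<^sub>R p = (l * r * (1 - l)) *\<^sub>R q" by simp
  then have "(1 - l) *\<^sub>R (c - b) = l *\<^sub>R (a - c)" using l r by (simp add: p_def q_def mult.commute)
  then show ?thesis by (simp add: algebra_simps)
qed

section \<open>Isometries from the sphere of a sum of strictly convex spaces\<close>

text \<open>Treats both sums at once: \<open>Z\<close> is a linear space of bounded families in
  which single coordinates may be changed freely.\<close>

locale sum_sphere_isometry =
  fixes X :: "'i \<Rightarrow> 'a::real_normed_vector set" and Z :: "('i \<Rightarrow> 'a) set"
    and Y :: "'b::real_normed_vector set" and \<Delta> :: "('i \<Rightarrow> 'a) \<Rightarrow> 'b" and S :: "('i \<Rightarrow> 'a) set"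
  defines "S \<equiv> {z \<in> Z. sup_norm z = 1}"
  assumes two_indices: "\<exists>\<gamma>1 \<gamma>2::'i. \<gamma>1 \<noteq> \<gamma>2"
    and subspace_X: "subspace (X \<gamma>)"
    and strictly_convex_X: "strictly_convex_sp (X \<gamma>)"
    and unit_vector_X: "\<exists>e\<in>X \<gamma>. norm e = 1"
    and smooth_dense: "{x \<in> X \<gamma>. norm x = 1} \<subseteq> closure (smooth_points (X \<gamma>))"
    and Z_linf: "Z \<subseteq> linf_sum X"
    and Z_zero: "(\<lambda>_. 0) \<in> Z"
    and Z_add: "x \<in> Z \<Longrightarrow> z \<in> Z \<Longrightarrow> (\<lambda>\<gamma>. x \<gamma> + z \<gamma>) \<in> Z"
    and Z_scale: "z \<in> Z \<Longrightarrow> (\<lambda>\<gamma>. c *\<^sub>R z \<gamma>) \<in> Z"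
    and Z_upd: "z \<in> Z \<Longrightarrow> a \<in> X \<gamma> \<Longrightarrow> z(\<gamma> := a) \<in> Z"
    and subspace_Y: "subspace Y"
    and onto: "\<Delta> ` S = {y \<in> Y. norm y = 1}"
    and iso: "x \<in> S \<Longrightarrow> z \<in> S \<Longrightarrow> dist (\<Delta> x) (\<Delta> z) = sup_norm (\<lambda>\<gamma>. x \<gamma> - z \<gamma>)"
begin

lemma Z_X: "z \<in> Z \<Longrightarrow> z \<gamma> \<in> X \<gamma>"
  using Z_linf by (auto simp: linf_sum_def)

lemma Z_diff: "x \<in> Z \<Longrightarrow> z \<in> Z \<Longrightarrow> (\<lambda>\<gamma>. x \<gamma> - z \<gamma>) \<in> Z"
  using Z_add[OF _ Z_scale[of z "- 1"]] by simp

lemma Z_neg: "z \<in> Z \<Longrightarrow> (\<lambda>\<gamma>. - z \<gamma>) \<in> Z"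
  using Z_scale[of z "- 1"] by simp

lemma norm_le_sup_norm: "z \<in> Z \<Longrightarrow> norm (z \<gamma>) \<le> sup_norm z"
  unfolding sup_norm_def using Z_linf by (auto simp: linf_sum_def intro!: cSUP_upper)

lemma sup_norm_le: "(\<And>\<gamma>. norm (z \<gamma>) \<le> c) \<Longrightarrow> sup_norm z \<le> c"
  for z :: "'i \<Rightarrow> 'a"
  unfolding sup_norm_def by (rule cSUP_least) auto

lemma sup_norm_eqI:
  assumes "z \<in> Z" "\<And>\<gamma>. norm (z \<gamma>) \<le> c" "norm (z \<beta>) = c"
  shows "sup_norm z = c"
  using sup_norm_le[of z c] norm_le_sup_norm[of z \<beta>] assms by force

lemma sup_norm_nonneg: "z \<in> Z \<Longrightarrow> 0 \<le> sup_norm z"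
  by (rule order_trans[OF norm_ge_zero norm_le_sup_norm])

lemma sup_norm_scale:
  assumes z: "z \<in> Z"
  shows "sup_norm (\<lambda>\<gamma>. c *\<^sub>R z \<gamma>) = \<bar>c\<bar> * sup_norm z"
proof (cases "c = 0")
  case True
  then show ?thesis by (simp add: sup_norm_def)
next
  case False
  have "sup_norm z \<le> sup_norm (\<lambda>\<gamma>. c *\<^sub>R z \<gamma>) / \<bar>c\<bar>"
    using norm_le_sup_norm[OF Z_scale[OF z, of c]] False
    by (intro sup_norm_le) (simp add: field_simps)
  then have "\<bar>c\<bar> * sup_norm z \<le> sup_norm (\<lambda>\<gamma>. c *\<^sub>R z \<gamma>)" using False by (simp add: field_simps)
  moreover have "sup_norm (\<lambda>\<gamma>. c *\<^sub>R z \<gamma>) \<le> \<bar>c\<bar> * sup_norm z"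
    using norm_le_sup_norm[OF z] by (intro sup_norm_le) (simp add: mult_left_mono)
  ultimately show ?thesis by simp
qed

lemma S_Z: "z \<in> S \<Longrightarrow> z \<in> Z" and S_sup_norm: "z \<in> S \<Longrightarrow> sup_norm z = 1"
  by (simp_all add: S_def)

lemma S_le: "z \<in> S \<Longrightarrow> norm (z \<gamma>) \<le> 1"
  using norm_le_sup_norm[of z \<gamma>] by (simp add: S_def)

lemma S_I: "z \<in> Z \<Longrightarrow> (\<And>\<gamma>. norm (z \<gamma>) \<le> 1) \<Longrightarrow> norm (z \<beta>) = 1 \<Longrightarrow> z \<in> S"
  by (simp add: S_def sup_norm_eqI)

lemma S_upd: "z \<in> S \<Longrightarrow> a \<in> X \<gamma> \<Longrightarrow> norm a = 1 \<Longrightarrow> z(\<gamma> := a) \<in> S"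
  by (rule S_I[of _ \<gamma>]) (simp_all add: Z_upd S_Z S_le)

lemma S_neg: "z \<in> S \<Longrightarrow> (\<lambda>\<gamma>. - z \<gamma>) \<in> S"
  using sup_norm_scale[of z "- 1"] by (simp add: S_def Z_neg)

lemma Delta_Y: "z \<in> S \<Longrightarrow> \<Delta> z \<in> Y" and norm_Delta: "z \<in> S \<Longrightarrow> norm (\<Delta> z) = 1"
  using onto by auto

lemma Delta_surj: "y \<in> Y \<Longrightarrow> norm y = 1 \<Longrightarrow> \<exists>z\<in>S. \<Delta> z = y"
  using onto by (metis (mono_tags, lifting) imageE mem_Collect_eq)

lemma norm_Delta_diff: "x \<in> S \<Longrightarrow> z \<in> S \<Longrightarrow> norm (\<Delta> x - \<Delta> z) = sup_norm (\<lambda>\<gamma>. x \<gamma> - z \<gamma>)"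
  using iso by (simp add: dist_norm)

lemma norm_Delta_upd:
  assumes z: "z \<in> S" "z(\<gamma> := a) \<in> S"
  shows "norm (\<Delta> z - \<Delta> (z(\<gamma> := a))) = norm (z \<gamma> - a)"
  unfolding norm_Delta_diff[OF z]
  by (rule sup_norm_eqI[OF Z_diff[OF S_Z[OF z(1)] S_Z[OF z(2)]], of _ \<gamma>]) auto

section \<open>Faces of the sphere and their inner points\<close>

definition face :: "'i \<Rightarrow> 'a \<Rightarrow> ('i \<Rightarrow> 'a) set" where
  "face \<gamma> u = {z \<in> S. z \<gamma> = u}"

text \<open>The bound \<open>c\<close> is uniform, so the other coordinates cannot even approach
  norm 1; with infinitely many indices this is stronger than each having norm below 1.\<close>

definition inner_face :: "'i \<Rightarrow> 'a \<Rightarrow> ('i \<Rightarrow> 'a) set" where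
  "inner_face \<gamma> u = {z \<in> face \<gamma> u. \<exists>c<1. \<forall>\<beta>. \<beta> \<noteq> \<gamma> \<longrightarrow> norm (z \<beta>) \<le> c}"

lemma face_S: "z \<in> face \<gamma> u \<Longrightarrow> z \<in> S" and face_at: "z \<in> face \<gamma> u \<Longrightarrow> z \<gamma> = u"
  by (simp_all add: face_def)

lemma inner_face_face: "z \<in> inner_face \<gamma> u \<Longrightarrow> z \<in> face \<gamma> u"
  by (simp add: inner_face_def)

lemma face_neg: "z \<in> face \<gamma> u \<Longrightarrow> (\<lambda>\<gamma>. - z \<gamma>) \<in> face \<gamma> (- u)"
  by (simp add: face_def S_neg)

text \<open>If \<open>y \<gamma> \<noteq> u\<close>, strict convexity keeps coordinate
  \<open>\<gamma>\<close> of the sum below 2, and the others are bounded by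
  \<open>1 + c < 2\<close>.\<close>

lemma inner_face_star:
  assumes u: "u \<in> X \<gamma>" "norm u = 1" and z: "z \<in> inner_face \<gamma> u" and y: "y \<in> S"
  shows "sup_norm (\<lambda>\<beta>. y \<beta> + z \<beta>) = 2 \<longleftrightarrow> y \<gamma> = u"
proof
  from z obtain c where zS: "z \<in> S" "z \<gamma> = u" and c: "c < 1" "\<And>\<beta>. \<beta> \<noteq> \<gamma> \<Longrightarrow> norm (z \<beta>) \<le> c"
    by (auto simp: inner_face_def face_def)
  have Z: "(\<lambda>\<beta>. y \<beta> + z \<beta>) \<in> Z" using y zS by (intro Z_add S_Z)
  have le2: "norm (y \<beta> + z \<beta>) \<le> 2" for \<beta>
    using norm_triangle_ineq[of "y \<beta>" "z \<beta>"] S_le[OF y, of \<beta>] S_le[OF zS(1), of \<beta>] by linarith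
  show "sup_norm (\<lambda>\<beta>. y \<beta> + z \<beta>) = 2" if "y \<gamma> = u"
  proof (rule sup_norm_eqI[OF Z le2])
    show "norm (y \<gamma> + z \<gamma>) = 2"
      using that zS u by (simp add: scaleR_2[symmetric])
  qed
  show "y \<gamma> = u" if eq: "sup_norm (\<lambda>\<beta>. y \<beta> + z \<beta>) = 2"
  proof (rule ccontr)
    assume ne: "y \<gamma> \<noteq> u"
    have "norm (y \<gamma> + u) \<noteq> 2"
      using strictly_convex_sp_add_eq_2[OF strictly_convex_X subspace_X Z_X[OF S_Z[OF y]] u(1)]
        S_le[OF y] u ne by auto
    then have lt: "norm (y \<gamma> + u) < 2" using le2[of \<gamma>] zS by simp
    have "norm (y \<beta> + z \<beta>) \<le> max (norm (y \<gamma> + u)) (1 + c)" for \<beta>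
      using norm_triangle_ineq[of "y \<beta>" "z \<beta>"] S_le[OF y, of \<beta>] c(2)[of \<beta>] zS
      by (cases "\<beta> = \<gamma>") auto
    then have "sup_norm (\<lambda>\<beta>. y \<beta> + z \<beta>) \<le> max (norm (y \<gamma> + u)) (1 + c)" by (rule sup_norm_le)
    then show False using eq lt c(1) by simp
  qed
qed

lemma inner_face_dense:
  assumes u: "u \<in> X \<gamma>" "norm u = 1" and z: "z \<in> face \<gamma> u" and e: "0 < e"
  obtains z' where "z' \<in> inner_face \<gamma> u" "sup_norm (\<lambda>\<beta>. z \<beta> - z' \<beta>) \<le> e"
proof -
  \<comment> \<open>The other coordinates are shrunk by the factor \<open>1 - d\<close>; the cap 1/2
    keeps it positive.\<close>
  define d where "d = min e (1/2)"
  have d: "0 < d" "d \<le> e" "d < 1" using e by (auto simp: d_def)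
  define z' where "z' = (\<lambda>\<beta>. (1 - d) *\<^sub>R z \<beta>)(\<gamma> := u)"
  have zS: "z \<in> S" "z \<gamma> = u" using z by (auto simp: face_def)
  have le: "norm (z' \<beta>) \<le> 1 - d" if "\<beta> \<noteq> \<gamma>" for \<beta>
    using that d mult_left_mono[OF S_le[OF zS(1), of \<beta>], of "1 - d"] by (simp add: z'_def)
  have "z' \<in> S"
  proof (rule S_I[of _ \<gamma>])
    show "z' \<in> Z" unfolding z'_def using zS u by (intro Z_upd Z_scale S_Z)
    show "norm (z' \<gamma>) = 1" using u by (simp add: z'_def)
    then show "norm (z' \<beta>) \<le> 1" for \<beta> using le[of \<beta>] d by (cases "\<beta> = \<gamma>") auto
  qed
  then have "z' \<in> inner_face \<gamma> u"
    using le d by (auto simp: inner_face_def face_def z'_def intro!: exI[of _ "1 - d"])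
  moreover have "sup_norm (\<lambda>\<beta>. z \<beta> - z' \<beta>) \<le> e"
  proof (rule sup_norm_le)
    fix \<beta>
    have "norm (z \<beta> - z' \<beta>) \<le> d"
      using d zS mult_left_mono[OF S_le[OF zS(1), of \<beta>], of d] by (simp add: z'_def algebra_simps)
    then show "norm (z \<beta> - z' \<beta>) \<le> e" using d by simp
  qed
  ultimately show thesis using that by blast
qed

lemma inner_face_nonempty:
  assumes "u \<in> X \<gamma>" "norm u = 1"
  shows "inner_face \<gamma> u \<noteq> {}"
proof -
  have "(\<lambda>_. 0)(\<gamma> := u) \<in> S" using assms by (intro S_I[of _ \<gamma>] Z_upd Z_zero) auto
  then have "(\<lambda>_. 0)(\<gamma> := u) \<in> inner_face \<gamma> u"
    by (auto simp: inner_face_def face_def intro!: exI[of _ 0])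
  then show ?thesis by blast
qed

section \<open>Images of faces: closedness, antipodes, convexity\<close>

definition image_face :: "'i \<Rightarrow> 'a \<Rightarrow> 'b set" where
  "image_face \<gamma> u = \<Delta> ` face \<gamma> u"

lemma image_face_Y: "y \<in> image_face \<gamma> u \<Longrightarrow> y \<in> Y"
  and image_face_norm: "y \<in> image_face \<gamma> u \<Longrightarrow> norm y = 1"
  using Delta_Y norm_Delta by (auto simp: image_face_def face_def)

context
  fixes \<gamma> u assumes u: "u \<in> X \<gamma>" "norm u = 1"
begin

text \<open>The image of a face is the star of \<open>-\<Delta>(-z)\<close> for every inner point \<open>z\<close> of the face.\<close>
lemma image_face_iff:
  assumes z: "z \<in> inner_face \<gamma> u"
  shows "y \<in> image_face \<gamma> u \<longleftrightarrow> y \<in> Y \<and> norm y = 1 \<and> norm (y - \<Delta> (\<lambda>\<beta>. - z \<beta>)) = 2"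
proof -
  have zS: "(\<lambda>\<beta>. - z \<beta>) \<in> S" using z by (intro S_neg face_S inner_face_face)
  have "norm (\<Delta> x - \<Delta> (\<lambda>\<beta>. - z \<beta>)) = 2 \<longleftrightarrow> x \<gamma> = u" if "x \<in> S" for x
    using norm_Delta_diff[OF that zS] inner_face_star[OF u z that] by simp
  then show ?thesis
    using Delta_surj[of y] Delta_Y norm_Delta by (auto simp: image_face_def face_def)
qed

text \<open>By \<open>image_face_iff\<close> the image is cut out of \<open>Y\<close> by two
  equations between norms, which survive limits.\<close>

lemma image_face_closed:
  assumes y: "y \<in> Y" and approx: "\<And>e. 0 < e \<Longrightarrow> \<exists>y'\<in>image_face \<gamma> u. norm (y - y') \<le> e"
  shows "y \<in> image_face \<gamma> u"
proof -
  obtain z where z: "z \<in> inner_face \<gamma> u" using inner_face_nonempty[OF u] by blast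
  let ?b = "\<Delta> (\<lambda>\<beta>. - z \<beta>)"
  have *: "1 \<le> norm y + e \<and> norm y \<le> 1 + e \<and> 2 \<le> norm (y - ?b) + e \<and> norm (y - ?b) \<le> 2 + e"
    if "0 < e" for e
  proof -
    obtain y' where y': "y' \<in> image_face \<gamma> u" "norm (y - y') \<le> e" using approx[of e] \<open>0 < e\<close> by blast
    have "norm y' = 1" "norm (y' - ?b) = 2" using y'(1) image_face_iff[OF z] by auto
    then show ?thesis
      using y'(2) norm_triangle_ineq3[of y y'] norm_triangle_ineq3[of "y - ?b" "y' - ?b"] by auto
  qed
  have "1 \<le> norm y" "norm y \<le> 1" "2 \<le> norm (y - ?b)" "norm (y - ?b) \<le> 2"
    using * by (auto intro: field_le_epsilon)
  then show ?thesis using image_face_iff[OF z] y by auto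
qed

text \<open>The centre belongs to its own star, since adding it to itself gives norm 2.\<close>

lemma neg_Delta_neg_inner:
  assumes z: "z \<in> inner_face \<gamma> u"
  shows "- \<Delta> (\<lambda>\<beta>. - z \<beta>) \<in> image_face \<gamma> u"
proof -
  have zS: "(\<lambda>\<beta>. - z \<beta>) \<in> S" using z by (intro S_neg face_S[of z] inner_face_face)
  have "- \<Delta> (\<lambda>\<beta>. - z \<beta>) - \<Delta> (\<lambda>\<beta>. - z \<beta>) = - 2 *\<^sub>R \<Delta> (\<lambda>\<beta>. - z \<beta>)"
    by (metis (no_types) add_uminus_conv_diff minus_add_distrib scaleR_2 scaleR_minus_left)
  then show ?thesis
    using norm_Delta[OF zS] Delta_Y[OF zS] by (simp add: image_face_iff[OF z] subspace_neg subspace_Y)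
qed

lemma neg_Delta_neg_approx:
  assumes z: "z \<in> face \<gamma> u" and e: "0 < e"
  obtains z' where "z' \<in> inner_face \<gamma> u" "norm (\<Delta> (\<lambda>\<beta>. - z \<beta>) - \<Delta> (\<lambda>\<beta>. - z' \<beta>)) \<le> e"
proof -
  obtain z' where z': "z' \<in> inner_face \<gamma> u" "sup_norm (\<lambda>\<beta>. z \<beta> - z' \<beta>) \<le> e"
    using inner_face_dense[OF u z e] by blast
  have S: "z \<in> S" "z' \<in> S" using z z' by (auto intro: face_S inner_face_face)
  have "norm (\<Delta> (\<lambda>\<beta>. - z \<beta>) - \<Delta> (\<lambda>\<beta>. - z' \<beta>)) = sup_norm (\<lambda>\<beta>. (- 1) *\<^sub>R (z \<beta> - z' \<beta>))"
    using S by (simp add: norm_Delta_diff S_neg)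
  also have "\<dots> = sup_norm (\<lambda>\<beta>. z \<beta> - z' \<beta>)"
    using sup_norm_scale[of "\<lambda>\<beta>. z \<beta> - z' \<beta>" "- 1"] S by (simp add: Z_diff S_Z)
  finally show thesis using z' that by simp
qed

lemma neg_Delta_neg:
  assumes z: "z \<in> face \<gamma> u"
  shows "- \<Delta> (\<lambda>\<beta>. - z \<beta>) \<in> image_face \<gamma> u"
proof (rule image_face_closed)
  show "- \<Delta> (\<lambda>\<beta>. - z \<beta>) \<in> Y"
    using z by (intro subspace_neg subspace_Y Delta_Y S_neg face_S)
  fix e :: real assume "0 < e"
  then obtain z' where z': "z' \<in> inner_face \<gamma> u" "norm (\<Delta> (\<lambda>\<beta>. - z \<beta>) - \<Delta> (\<lambda>\<beta>. - z' \<beta>)) \<le> e"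
    using neg_Delta_neg_approx[OF z] by blast
  then show "\<exists>y'\<in>image_face \<gamma> u. norm (- \<Delta> (\<lambda>\<beta>. - z \<beta>) - y') \<le> e"
    using neg_Delta_neg_inner by (auto simp: norm_minus_commute intro!: bexI[of _ "- \<Delta> (\<lambda>\<beta>. - z' \<beta>)"])
qed

text \<open>The star of \<open>- \<Delta> (\<lambda>\<beta>. - z \<beta>)\<close> is star-shaped
  about its centre.\<close>

lemma image_face_segment:
  assumes z: "z \<in> inner_face \<gamma> u" and y: "y \<in> image_face \<gamma> u" and l: "0 \<le> l" "l \<le> 1"
  shows "l *\<^sub>R (- \<Delta> (\<lambda>\<beta>. - z \<beta>)) + (1 - l) *\<^sub>R y \<in> image_face \<gamma> u"
proof -
  let ?b = "- \<Delta> (\<lambda>\<beta>. - z \<beta>)"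
  have b: "?b \<in> Y" "norm ?b = 1"
    using image_face_Y[OF neg_Delta_neg_inner[OF z]] image_face_norm[OF neg_Delta_neg_inner[OF z]]
    by simp_all
  have y': "y \<in> Y" "norm y = 1" "norm (?b + y) = 2" using y image_face_iff[OF z] by auto
  \<comment> \<open>Adding the centre to the point of weight \<open>l\<close> gives twice the point
    of weight \<open>r\<close> on the same segment.\<close>
  define r where "r = (1 + l) / 2"
  have r: "0 \<le> r" "r \<le> 1" "l = 2 * r - 1" using l by (simp_all add: r_def field_simps)
  have "l *\<^sub>R ?b + (1 - l) *\<^sub>R y + ?b = 2 *\<^sub>R (r *\<^sub>R ?b + (1 - r) *\<^sub>R y)"
    unfolding r(3) scaleR_add_right scaleR_scaleR by (simp add: algebra_simps)
  also have "norm \<dots> = 2"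
    using norm_segment_eq_1[OF b(2) y'(2,3) r(1,2)] by simp
  finally have "norm (l *\<^sub>R ?b + (1 - l) *\<^sub>R y + ?b) = 2" .
  moreover have "l *\<^sub>R ?b + (1 - l) *\<^sub>R y \<in> Y"
    using b y' subspace_Y by (intro subspace_add subspace_scale)
  ultimately show ?thesis
    using norm_segment_eq_1[OF b(2) y'(2,3) l] by (simp add: image_face_iff[OF z])
qed

end

text \<open>A substitute for oddness of \<open>\<Delta>\<close>: \<open>neg_Delta_neg\<close> is
  applied to the antipode of a preimage of \<open>y\<close>.\<close>

lemma neg_image_face:
  assumes u: "u \<in> X \<gamma>" "norm u = 1" and y: "y \<in> image_face \<gamma> u"
  shows "- y \<in> image_face \<gamma> (- u)"
proof -
  obtain z where z: "z \<in> face \<gamma> u" "y = \<Delta> z" using y by (auto simp: image_face_def)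
  show ?thesis
    using neg_Delta_neg[OF _ _ face_neg[OF z(1)]] u z(2) subspace_X by (simp add: subspace_neg)
qed

text \<open>By \<open>neg_image_face\<close> every \<open>y1\<close> in the image has the form
  \<open>- \<Delta> (\<lambda>\<beta>. - z \<beta>)\<close>, hence is a limit of centres. Segments
  from centres to \<open>y2\<close> stay in the image, which is closed.\<close>

lemma convex_image_face:
  assumes u: "u \<in> X \<gamma>" "norm u = 1"
  shows "convex (image_face \<gamma> u)"
proof (rule convexI)
  fix y1 y2 and l m :: real
  assume y: "y1 \<in> image_face \<gamma> u" "y2 \<in> image_face \<gamma> u" and lm: "0 \<le> l" "0 \<le> m" "l + m = 1"
  obtain w where w: "w \<in> face \<gamma> (- u)" "- y1 = \<Delta> w"
    using neg_image_face[OF u y(1)] by (auto simp: image_face_def)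
  define z where "z = (\<lambda>\<beta>. - w \<beta>)"
  have z: "z \<in> face \<gamma> u" "y1 = - \<Delta> (\<lambda>\<beta>. - z \<beta>)"
    using face_neg[OF w(1)] w(2)[symmetric] by (simp_all add: z_def)
  show "l *\<^sub>R y1 + m *\<^sub>R y2 \<in> image_face \<gamma> u"
  proof (rule image_face_closed[OF u])
    show "l *\<^sub>R y1 + m *\<^sub>R y2 \<in> Y"
      using y subspace_Y by (intro subspace_add subspace_scale image_face_Y)
    fix e :: real assume "0 < e"
    then obtain z' where z': "z' \<in> inner_face \<gamma> u"
        "norm (\<Delta> (\<lambda>\<beta>. - z \<beta>) - \<Delta> (\<lambda>\<beta>. - z' \<beta>)) \<le> e"
      using neg_Delta_neg_approx[OF u z(1)] by blast
    let ?y = "l *\<^sub>R (- \<Delta> (\<lambda>\<beta>. - z' \<beta>)) + (1 - l) *\<^sub>R y2"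
    have m: "m = 1 - l" using lm by simp
    have "?y \<in> image_face \<gamma> u" using image_face_segment[OF u z'(1) y(2)] lm by simp
    moreover have "norm (l *\<^sub>R y1 + m *\<^sub>R y2 - ?y) \<le> e"
    proof -
      have "l *\<^sub>R y1 + m *\<^sub>R y2 - ?y = l *\<^sub>R (\<Delta> (\<lambda>\<beta>. - z' \<beta>) - \<Delta> (\<lambda>\<beta>. - z \<beta>))"
        by (simp add: m z(2) algebra_simps)
      also have "norm \<dots> \<le> 1 * norm (\<Delta> (\<lambda>\<beta>. - z' \<beta>) - \<Delta> (\<lambda>\<beta>. - z \<beta>))"
        using lm unfolding norm_scaleR by (intro mult_right_mono) auto
      finally show ?thesis using z'(2) by (simp add: norm_minus_commute)
    qed
    ultimately show "\<exists>y'\<in>image_face \<gamma> u. norm (l *\<^sub>R y1 + m *\<^sub>R y2 - y') \<le> e" by blast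
  qed
qed

section \<open>Functionals supporting the image of a face\<close>

definition face_functional :: "'i \<Rightarrow> 'a \<Rightarrow> ('b \<Rightarrow> real) \<Rightarrow> bool" where
  "face_functional \<gamma> u f \<longleftrightarrow> linear f \<and> (\<forall>y. f y \<le> norm y) \<and> (\<forall>y\<in>image_face \<gamma> u. f y = 1)"

lemma face_functional_exists:
  assumes u: "u \<in> X \<gamma>" "norm u = 1"
  obtains f where "face_functional \<gamma> u f"
proof -
  have "image_face \<gamma> u \<noteq> {}"
    using inner_face_nonempty[OF u] inner_face_face by (auto simp: image_face_def)
  then obtain f where "linear f" "\<And>y. f y \<le> norm y" "\<And>y. y \<in> image_face \<gamma> u \<Longrightarrow> f y = 1"
    using functional_one_on_convex[OF convex_image_face[OF u]] image_face_norm by blast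
  then have "face_functional \<gamma> u f" by (simp add: face_functional_def)
  then show thesis by (rule that)
qed

text \<open>Converts upper bounds at \<open>- u\<close> into lower bounds at
  \<open>u\<close>.\<close>

lemma face_functional_neg:
  assumes u: "u \<in> X \<gamma>" "norm u = 1" and f: "face_functional \<gamma> u f"
  shows "face_functional \<gamma> (- u) (\<lambda>y. - f y)"
proof -
  have lin: "linear f" using f by (simp add: face_functional_def)
  have "- f y \<le> norm y" for y
    using f[unfolded face_functional_def, THEN conjunct2, THEN conjunct1, rule_format, of "- y"]
    by (simp add: linear_neg[OF lin])
  moreover have "- f y = 1" if "y \<in> image_face \<gamma> (- u)" for y
    using neg_image_face[OF _ _ that] u f subspace_X linear_neg[OF lin, of y]
    by (simp add: subspace_neg face_functional_def)
  ultimately show ?thesis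
    using linear_compose_neg[OF lin] by (simp add: face_functional_def)
qed

lemma face_functional_lipschitz:
  assumes "face_functional \<gamma> u f"
  shows "f x - f y \<le> norm (x - y)"
  using assms by (simp add: face_functional_def flip: linear_diff)

text \<open>Replacing \<open>z \<gamma>\<close> by \<open>- u\<close> moves the image by exactly
  \<open>norm (z \<gamma> + u)\<close>, to a point where \<open>f\<close> is -1.\<close>

lemma face_functional_upper:
  assumes u: "u \<in> X \<gamma>" "norm u = 1" and f: "face_functional \<gamma> u f" and z: "z \<in> S"
  shows "f (\<Delta> z) \<le> norm (z \<gamma> + u) - 1"
proof -
  have u': "- u \<in> X \<gamma>" "norm (- u) = 1" using u subspace_X by (auto simp: subspace_neg)
  have zu: "z(\<gamma> := - u) \<in> S" using z u' by (rule S_upd)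
  then have "\<Delta> (z(\<gamma> := - u)) \<in> image_face \<gamma> (- u)" by (auto simp: image_face_def face_def)
  then have "f (\<Delta> (z(\<gamma> := - u))) = - 1"
    using face_functional_neg[OF u f] by (auto simp: face_functional_def)
  then show ?thesis
    using face_functional_lipschitz[OF f, of "\<Delta> z" "\<Delta> (z(\<gamma> := - u))"] norm_Delta_upd[OF z zu]
    by simp
qed

text \<open>Moving \<open>z(\<gamma>)\<close> towards \<open>u\<close> inside a face of another coordinate turns the estimate of
  \<open>face_functional_upper\<close> into a bound by difference quotients of the norm at \<open>u\<close>.\<close>
lemma face_functional_le_norm_deriv:
  assumes ne: "\<gamma>' \<noteq> \<gamma>" and z: "z \<in> S" "norm (z \<gamma>') = 1"
    and u: "u \<in> X \<gamma>" "norm u = 1" and f: "face_functional \<gamma> u f"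
  shows "f (\<Delta> z) \<le> norm_deriv u (z \<gamma>)"
proof (rule norm_deriv_eqI_ge[OF _ u(2)])
  fix t :: real assume t: "1 < t"
  \<comment> \<open>Chosen so that \<open>2 - l = l * t\<close>: then
    \<open>l *\<^sub>R z \<gamma> + (1 - l) *\<^sub>R u\<close>, increased by \<open>u\<close>, is
    \<open>l *\<^sub>R (z \<gamma> + t *\<^sub>R u)\<close>.\<close>
  define l where "l = 2 / (t + 1)"
  have l: "0 < l" "l < 1" and tl: "l * t = 2 - l" using t by (auto simp: l_def field_simps)
  let ?v = "z \<gamma>'" and ?z2 = "z(\<gamma> := u)"
  have v: "?v \<in> X \<gamma>'" "norm ?v = 1" using z by (auto intro: Z_X S_Z)
  have z2: "?z2 \<in> S" using z(1) u by (rule S_upd)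
  have mem: "\<Delta> z \<in> image_face \<gamma>' ?v" "\<Delta> ?z2 \<in> image_face \<gamma>' ?v"
    using z z2 ne by (auto simp: image_face_def face_def)
  have "l *\<^sub>R \<Delta> z + (1 - l) *\<^sub>R \<Delta> ?z2 \<in> image_face \<gamma>' ?v"
    using l by (intro convexD[OF convex_image_face[OF v] mem]) auto
  then obtain w where w: "w \<in> S" "\<Delta> w = l *\<^sub>R \<Delta> z + (1 - l) *\<^sub>R \<Delta> ?z2"
    by (auto simp: image_face_def face_def)
  have dist: "norm (\<Delta> z - \<Delta> ?z2) = norm (z \<gamma> - u)" by (rule norm_Delta_upd[OF z(1) z2])
  have coord: "norm (x \<gamma> - y \<gamma>) \<le> norm (\<Delta> x - \<Delta> y)" if "x \<in> S" "y \<in> S" for x y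
    using norm_le_sup_norm[OF Z_diff, of x y \<gamma>] that by (simp add: norm_Delta_diff S_Z)
  have "\<Delta> w - \<Delta> z = (1 - l) *\<^sub>R (\<Delta> ?z2 - \<Delta> z)" "\<Delta> w - \<Delta> ?z2 = l *\<^sub>R (\<Delta> z - \<Delta> ?z2)"
    by (simp_all add: w(2) algebra_simps)
  then have "norm (\<Delta> w - \<Delta> z) = (1 - l) * norm (z \<gamma> - u)"
      "norm (\<Delta> w - \<Delta> ?z2) = l * norm (z \<gamma> - u)"
    using l dist by (simp_all add: norm_minus_commute)
  \<comment> \<open>Coordinate distances do not exceed distances of images, so
    \<open>w \<gamma>\<close> meets both bounds for interpolation between \<open>z \<gamma>\<close>
    and \<open>u\<close>.\<close>
  then have "w \<gamma> = l *\<^sub>R z \<gamma> + (1 - l) *\<^sub>R u"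
    using coord[OF w(1) z(1)] coord[OF w(1) z2] u z(1) w(1) l
    by (intro strictly_convex_sp_between[OF strictly_convex_X subspace_X]) (auto intro: Z_X S_Z)
  then have "w \<gamma> + u = l *\<^sub>R (z \<gamma> + t *\<^sub>R u)"
    by (simp add: scaleR_add_right tl) (simp add: algebra_simps scaleR_2)
  then have "f (\<Delta> w) \<le> l * norm (z \<gamma> + t *\<^sub>R u) - 1"
    using face_functional_upper[OF u f w(1)] l by simp
  moreover have "f (\<Delta> w) = l * f (\<Delta> z) + (1 - l)"
  proof -
    have lin: "linear f" using f by (simp add: face_functional_def)
    have "f (\<Delta> ?z2) = 1"
      using f z2 by (auto simp: face_functional_def image_face_def face_def)
    then show ?thesis by (simp add: w(2) linear_add[OF lin] linear_scale[OF lin])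
  qed
  \<comment> \<open>The constants combine to \<open>l - 2 = - (l * t)\<close>.\<close>
  ultimately have "l * f (\<Delta> z) \<le> l * (norm (z \<gamma> + t *\<^sub>R u) - t)"
    using tl by (simp add: algebra_simps)
  then show "f (\<Delta> z) \<le> norm (z \<gamma> + t *\<^sub>R u) - t" using l by simp
qed

section \<open>Values of the functionals at smooth directions\<close>

lemma smooth_pointsD:
  assumes "u \<in> smooth_points (X \<gamma>)"
  shows "u \<in> X \<gamma>" "norm u = 1" and "a \<in> X \<gamma> \<Longrightarrow> norm_deriv u (- a) = - norm_deriv u a"
  using assms norm_deriv_odd_if_smooth[of "X \<gamma>" u a] subspace_X[of \<gamma>]
  by (auto simp: smooth_points_def smooth_point_def subspace_neg)

lemma norm_deriv_smooth_linear:
  assumes u: "u \<in> smooth_points (X \<gamma>)" and ab: "a \<in> X \<gamma>" "b \<in> X \<gamma>"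
  shows "norm_deriv u (a + b) = norm_deriv u a + norm_deriv u b"
    and "norm_deriv u (c *\<^sub>R a) = c * norm_deriv u a"
  using smooth_pointsD[OF u] ab
  by (auto intro!: sublinear_additive_if_odd sublinear_scale_if_odd sublinear_norm_deriv)

text \<open>A smooth \<open>u\<close> at distance less than 1 from the normalized \<open>a\<close>
  has positive derivative there, since the derivative is 1 at \<open>u\<close> and
  1-Lipschitz.\<close>

lemma smooth_points_separate:
  assumes a: "a \<in> X \<gamma>" and zero: "\<And>u. u \<in> smooth_points (X \<gamma>) \<Longrightarrow> norm_deriv u a = 0"
  shows "a = 0"
proof (rule ccontr)
  assume ne: "a \<noteq> 0"
  define e where "e = (1 / norm a) *\<^sub>R a"
  have "e \<in> {x \<in> X \<gamma>. norm x = 1}" using a ne subspace_X by (simp add: e_def subspace_scale)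
  then have "e \<in> closure (smooth_points (X \<gamma>))" using smooth_dense by blast
  then obtain u where u: "u \<in> smooth_points (X \<gamma>)" "dist u e < 1"
    by (meson closure_approachable zero_less_one)
  have "norm_deriv u e = 0"
    using zero[OF u(1)] norm_deriv_smooth_linear(2)[OF u(1) a a] by (simp add: e_def)
  then show False
    using norm_deriv_lipschitz[of u u e] norm_deriv_self[of u] smooth_pointsD(2)[OF u(1)] u(2)
    by (simp add: dist_norm)
qed

text \<open>The upper bounds for \<open>u\<close>, \<open>f\<close> and for \<open>- u\<close>,
  \<open>- f\<close> meet because the derivative at a smooth point is odd.\<close>

lemma face_functional_eq_off:
  assumes ne: "\<gamma>' \<noteq> \<gamma>" and z: "z \<in> S" "norm (z \<gamma>') = 1"
    and u: "u \<in> smooth_points (X \<gamma>)" and f: "face_functional \<gamma> u f"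
  shows "f (\<Delta> z) = norm_deriv u (z \<gamma>)"
proof (rule antisym)
  note uX = smooth_pointsD(1,2)[OF u]
  show "f (\<Delta> z) \<le> norm_deriv u (z \<gamma>)" by (rule face_functional_le_norm_deriv[OF ne z uX f])
  have "- f (\<Delta> z) \<le> norm_deriv (- u) (z \<gamma>)"
    using uX subspace_X
    by (intro face_functional_le_norm_deriv[OF ne z _ _ face_functional_neg[OF uX f]])
      (auto simp: subspace_neg)
  also have "\<dots> = - norm_deriv u (z \<gamma>)"
    using smooth_pointsD(3)[OF u] z by (simp add: norm_deriv_uminus uX Z_X S_Z)
  finally show "norm_deriv u (z \<gamma>) \<le> f (\<Delta> z)" by simp
qed

text \<open>On the face of \<open>\<gamma>\<close> the functionals of the other coordinates are known and determine a point,
  so the preimage of a convex combination is the convex combination of the preimages.\<close>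
lemma Delta_affine_on_face:
  assumes v: "v \<in> X \<gamma>" "norm v = 1" and z: "z1 \<in> face \<gamma> v" "z2 \<in> face \<gamma> v"
    and l: "0 \<le> l" "l \<le> 1"
  shows "\<Delta> (\<lambda>\<beta>. l *\<^sub>R z1 \<beta> + (1 - l) *\<^sub>R z2 \<beta>) = l *\<^sub>R \<Delta> z1 + (1 - l) *\<^sub>R \<Delta> z2"
proof -
  have "l *\<^sub>R \<Delta> z1 + (1 - l) *\<^sub>R \<Delta> z2 \<in> image_face \<gamma> v"
    using z l by (intro convexD[OF convex_image_face[OF v]]) (auto simp: image_face_def)
  then obtain w where w: "w \<in> S" "w \<gamma> = v" "\<Delta> w = l *\<^sub>R \<Delta> z1 + (1 - l) *\<^sub>R \<Delta> z2"
    by (auto simp: image_face_def face_def)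
  have zS: "z1 \<in> S" "z1 \<gamma> = v" "z2 \<in> S" "z2 \<gamma> = v" using z by (auto simp: face_def)
  have "w \<beta> = l *\<^sub>R z1 \<beta> + (1 - l) *\<^sub>R z2 \<beta>" for \<beta>
  proof (cases "\<beta> = \<gamma>")
    case True
    then show ?thesis using w zS by (simp add: algebra_simps)
  next
    case False
    let ?c = "l *\<^sub>R z1 \<beta> + (1 - l) *\<^sub>R z2 \<beta>"
    have X: "w \<beta> \<in> X \<beta>" "z1 \<beta> \<in> X \<beta>" "z2 \<beta> \<in> X \<beta>" using w zS by (auto intro: Z_X S_Z)
    note sub = subspace_add[OF subspace_X] subspace_scale[OF subspace_X] subspace_diff[OF subspace_X]
    have "w \<beta> - ?c = 0"
    proof (rule smooth_points_separate)
      show "w \<beta> - ?c \<in> X \<beta>" using X by (intro sub)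
      fix u assume u: "u \<in> smooth_points (X \<beta>)"
      obtain f where f: "face_functional \<beta> u f"
        using face_functional_exists[OF smooth_pointsD(1,2)[OF u]] by blast
      have lin: "linear f" using f by (simp add: face_functional_def)
      \<comment> \<open>The coordinate \<open>\<gamma>\<close> of \<open>x\<close> has norm one and
        differs from \<open>\<beta>\<close>, so the off-coordinate formula applies to
        \<open>w\<close>, \<open>z1\<close> and \<open>z2\<close> alike.\<close>
      have val: "f (\<Delta> x) = norm_deriv u (x \<beta>)" if "x \<in> S" "x \<gamma> = v" for x
        using that v False u f by (intro face_functional_eq_off[of \<gamma>]) auto
      have "norm_deriv u (w \<beta> - ?c) = norm_deriv u (w \<beta> + (- 1) *\<^sub>R ?c)"
        by (simp only: scaleR_minus1_left add_uminus_conv_diff)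
      also have "\<dots> = norm_deriv u (w \<beta>) + norm_deriv u ((- 1) *\<^sub>R ?c)"
        using X by (intro norm_deriv_smooth_linear[OF u] sub)
      also have "norm_deriv u ((- 1) *\<^sub>R ?c) = - 1 * norm_deriv u ?c"
        using X by (intro norm_deriv_smooth_linear[OF u] sub)
      also have "norm_deriv u ?c = norm_deriv u (l *\<^sub>R z1 \<beta>) + norm_deriv u ((1 - l) *\<^sub>R z2 \<beta>)"
        using X by (intro norm_deriv_smooth_linear[OF u] sub)
      also have "\<dots> = l * norm_deriv u (z1 \<beta>) + (1 - l) * norm_deriv u (z2 \<beta>)"
        using X by (simp add: norm_deriv_smooth_linear(2)[OF u])
      also have "\<dots> = f (\<Delta> w)"
        using zS by (simp add: val[symmetric] w(3) linear_add[OF lin] linear_scale[OF lin])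
      finally show "norm_deriv u (w \<beta> - ?c) = 0" using val[OF w(1,2)] by simp
    qed
    then show ?thesis by simp
  qed
  then have "w = (\<lambda>\<beta>. l *\<^sub>R z1 \<beta> + (1 - l) *\<^sub>R z2 \<beta>)" by blast
  then show ?thesis using w(3) by simp
qed

text \<open>When only coordinate \<open>\<gamma>\<close> is known to have norm one, \<open>z\<close>
  is a convex combination of two points of its face having unit vectors at another index
  \<open>\<gamma>'\<close>. Both have the same coordinate at \<open>\<gamma>\<close>, and
  \<open>\<Delta>\<close> is affine on the face.\<close>

lemma face_functional_eq_attained:
  assumes z: "z \<in> S" "norm (z \<beta>) = 1"
    and u: "u \<in> smooth_points (X \<gamma>)" and f: "face_functional \<gamma> u f"
  shows "f (\<Delta> z) = norm_deriv u (z \<gamma>)"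
proof (cases "\<beta> = \<gamma>")
  case False
  then show ?thesis using face_functional_eq_off z u f by blast
next
  case True
  obtain \<gamma>' where ne: "\<gamma>' \<noteq> \<gamma>" using two_indices by metis
  have zX: "z \<delta> \<in> X \<delta>" for \<delta> using z by (auto intro: Z_X S_Z)
  \<comment> \<open>The direction of \<open>z \<gamma>'\<close>, or any unit vector if that
    coordinate vanishes.\<close>
  obtain e where e: "e \<in> X \<gamma>'" "norm e = 1" "z \<gamma>' = norm (z \<gamma>') *\<^sub>R e"
  proof (cases "z \<gamma>' = 0")
    case True
    then show ?thesis using unit_vector_X[of \<gamma>'] that by auto
  next
    case False
    then show ?thesis
      using that[of "(1 / norm (z \<gamma>')) *\<^sub>R z \<gamma>'"] zX by (simp add: subspace_scale subspace_X)
  qed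
  have e': "- e \<in> X \<gamma>'" "norm (- e) = 1" using e subspace_X by (auto simp: subspace_neg)
  \<comment> \<open>The weight for which \<open>e\<close> and \<open>- e\<close> combine to
    \<open>z \<gamma>'\<close>.\<close>
  define l where "l = (1 + norm (z \<gamma>')) / 2"
  have l: "0 \<le> l" "l \<le> 1" using S_le[OF z(1), of \<gamma>'] by (auto simp: l_def)
  have zS: "z(\<gamma>' := e) \<in> S" "z(\<gamma>' := - e) \<in> S"
    using S_upd[OF z(1) e(1,2)] S_upd[OF z(1) e'] by auto
  have val: "f (\<Delta> (z(\<gamma>' := a))) = norm_deriv u (z \<gamma>)" if "z(\<gamma>' := a) \<in> S" "norm a = 1" for a
    using face_functional_eq_off[OF ne that(1) _ u f] that(2) ne by simp
  have "l *\<^sub>R e + (1 - l) *\<^sub>R (- e) = (2 * l - 1) *\<^sub>R e"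
    by (simp add: algebra_simps flip: scaleR_add_left)
  also have "2 * l - 1 = norm (z \<gamma>')" by (simp add: l_def field_simps)
  finally have "l *\<^sub>R e + (1 - l) *\<^sub>R (- e) = z \<gamma>'" by (simp only: e(3)[symmetric])
  then have "z \<delta> = l *\<^sub>R (z(\<gamma>' := e)) \<delta> + (1 - l) *\<^sub>R (z(\<gamma>' := - e)) \<delta>" for \<delta>
    by (cases "\<delta> = \<gamma>'") (simp_all flip: scaleR_add_left)
  then have "z = (\<lambda>\<delta>. l *\<^sub>R (z(\<gamma>' := e)) \<delta> + (1 - l) *\<^sub>R (z(\<gamma>' := - e)) \<delta>)"
    by (rule ext)
  moreover have "\<Delta> (\<lambda>\<delta>. l *\<^sub>R (z(\<gamma>' := e)) \<delta> + (1 - l) *\<^sub>R (z(\<gamma>' := - e)) \<delta>) =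
      l *\<^sub>R \<Delta> (z(\<gamma>' := e)) + (1 - l) *\<^sub>R \<Delta> (z(\<gamma>' := - e))"
  proof (rule Delta_affine_on_face[OF _ _ _ _ l])
    show "z \<gamma> \<in> X \<gamma>" "norm (z \<gamma>) = 1" using zX z True by simp_all
    show "z(\<gamma>' := e) \<in> face \<gamma> (z \<gamma>)" "z(\<gamma>' := - e) \<in> face \<gamma> (z \<gamma>)"
      using zS ne by (simp_all add: face_def)
  qed
  ultimately have "\<Delta> z = l *\<^sub>R \<Delta> (z(\<gamma>' := e)) + (1 - l) *\<^sub>R \<Delta> (z(\<gamma>' := - e))" by simp
  moreover have lin: "linear f" using f by (simp add: face_functional_def)
  ultimately have "f (\<Delta> z) = l * norm_deriv u (z \<gamma>) + (1 - l) * norm_deriv u (z \<gamma>)"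
    using val[OF zS(1) e(2)] val[OF zS(2) e'(2)]
    by (simp add: linear_add[OF lin] linear_scale[OF lin])
  then show ?thesis by (simp add: algebra_simps)
qed

text \<open>The supremum over the coordinates may not be attained. Normalizing a coordinate of norm
  above \<open>1 - e\<close> moves \<open>z\<close> by at most \<open>e\<close>, and both sides are
  1-Lipschitz.\<close>

theorem face_functional_eq:
  assumes z: "z \<in> S" and u: "u \<in> smooth_points (X \<gamma>)" and f: "face_functional \<gamma> u f"
  shows "f (\<Delta> z) = norm_deriv u (z \<gamma>)"
proof -
  have *: "\<bar>f (\<Delta> z) - norm_deriv u (z \<gamma>)\<bar> \<le> 2 * e" if e: "0 < e" "e < 1" for e
  proof -
    have "\<not> sup_norm z \<le> 1 - e" using S_sup_norm[OF z] e by simp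
    then obtain \<beta> where \<beta>: "1 - e < norm (z \<beta>)" using sup_norm_le[of z "1 - e"] not_le by blast
    define a where "a = (1 / norm (z \<beta>)) *\<^sub>R z \<beta>"
    have pos: "0 < norm (z \<beta>)" using \<beta> e by linarith
    have a: "a \<in> X \<beta>" "norm a = 1"
      using pos Z_X[OF S_Z[OF z]] by (auto simp: a_def intro!: subspace_scale subspace_X)
    have zS: "z(\<beta> := a) \<in> S" by (rule S_upd[OF z a])
    have "z \<beta> - a = (1 - 1 / norm (z \<beta>)) *\<^sub>R z \<beta>" by (simp add: a_def algebra_simps)
    then have "norm (z \<beta> - a) = \<bar>(1 - 1 / norm (z \<beta>)) * norm (z \<beta>)\<bar>" by (simp add: abs_mult)
    also have "(1 - 1 / norm (z \<beta>)) * norm (z \<beta>) = norm (z \<beta>) - 1"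
      using pos by (simp add: field_simps)
    finally have "norm (z \<beta> - a) = \<bar>norm (z \<beta>) - 1\<bar>" .
    then have d: "norm (z \<beta> - a) \<le> e" using \<beta> S_le[OF z, of \<beta>] by simp
    have nd: "norm (\<Delta> z - \<Delta> (z(\<beta> := a))) \<le> e" using norm_Delta_upd[OF z zS] d by simp
    have "norm (z \<gamma> - (z(\<beta> := a)) \<gamma>) \<le> e" using d e by auto
    moreover have "f (\<Delta> (z(\<beta> := a))) = norm_deriv u ((z(\<beta> := a)) \<gamma>)"
      using a by (intro face_functional_eq_attained[OF zS _ u f, of \<beta>]) simp
    ultimately show ?thesis
      using nd face_functional_lipschitz[OF f, of "\<Delta> z" "\<Delta> (z(\<beta> := a))"]
        face_functional_lipschitz[OF f, of "\<Delta> (z(\<beta> := a))" "\<Delta> z"]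
        norm_deriv_lipschitz[of u "z \<gamma>" "(z(\<beta> := a)) \<gamma>"]
        norm_deriv_lipschitz[of u "(z(\<beta> := a)) \<gamma>" "z \<gamma>"] smooth_pointsD(2)[OF u]
      unfolding norm_minus_commute[of "\<Delta> (z(\<beta> := a))"] norm_minus_commute[of "(z(\<beta> := a)) \<gamma>"]
      by linarith
  qed
  have "\<bar>f (\<Delta> z) - norm_deriv u (z \<gamma>)\<bar> \<le> 0 + e" if "0 < e" for e
    \<comment> \<open>The cap 1/2 keeps the parameter below 1, and its double is at most
      \<open>e\<close>.\<close>
    using *[of "min (1/2) (e/2)"] that by (cases "e < 1") (simp_all add: min_def)
  then have "\<bar>f (\<Delta> z) - norm_deriv u (z \<gamma>)\<bar> \<le> 0" by (rule field_le_epsilon)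
  then show ?thesis by simp
qed

section \<open>The positively homogeneous extension and its linearity\<close>

definition extension :: "('i \<Rightarrow> 'a) \<Rightarrow> 'b" where
  "extension z = sup_norm z *\<^sub>R \<Delta> (\<lambda>\<gamma>. (1 / sup_norm z) *\<^sub>R z \<gamma>)"

lemma normalized_S:
  assumes "z \<in> Z" "sup_norm z \<noteq> 0"
  shows "(\<lambda>\<gamma>. (1 / sup_norm z) *\<^sub>R z \<gamma>) \<in> S"
proof -
  have "sup_norm (\<lambda>\<gamma>. (1 / sup_norm z) *\<^sub>R z \<gamma>) = 1"
    using assms sup_norm_nonneg[OF assms(1)] by (subst sup_norm_scale) auto
  then show ?thesis using Z_scale[OF assms(1)] by (simp add: S_def)
qed

text \<open>If \<open>sup_norm z = 0\<close>, the outer factor makes the value 0, whatever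
  \<open>\<Delta>\<close> is off the sphere.\<close>

lemma norm_extension: "z \<in> Z \<Longrightarrow> norm (extension z) = sup_norm z"
  using norm_Delta[OF normalized_S, of z] sup_norm_nonneg[of z]
  by (cases "sup_norm z = 0") (simp_all add: extension_def)

lemma extension_Y: "z \<in> Z \<Longrightarrow> extension z \<in> Y"
  using Delta_Y[OF normalized_S, of z] subspace_Y
  by (cases "sup_norm z = 0") (simp_all add: extension_def subspace_0 subspace_scale)

lemma extension_S: "z \<in> S \<Longrightarrow> extension z = \<Delta> z"
  by (simp add: extension_def S_def)

lemma extension_surj:
  assumes y: "y \<in> Y"
  shows "\<exists>z\<in>Z. extension z = y"
proof (cases "y = 0")
  case True
  then show ?thesis using Z_zero norm_extension[OF Z_zero]
    by (intro bexI[of _ "\<lambda>_. 0"]) (auto simp: sup_norm_def)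
next
  case False
  then obtain z where z: "z \<in> S" "\<Delta> z = (1 / norm y) *\<^sub>R y"
    using Delta_surj[of "(1 / norm y) *\<^sub>R y"] y subspace_Y by (auto simp: subspace_scale)
  have "sup_norm (\<lambda>\<gamma>. norm y *\<^sub>R z \<gamma>) = norm y"
    using sup_norm_scale[OF S_Z[OF z(1)]] S_sup_norm[OF z(1)] by simp
  then have "extension (\<lambda>\<gamma>. norm y *\<^sub>R z \<gamma>) = y" using False z by (simp add: extension_def)
  then show ?thesis using Z_scale[OF S_Z[OF z(1)]] by blast
qed

lemma face_functional_extension:
  assumes z: "z \<in> Z" and u: "u \<in> smooth_points (X \<gamma>)" and f: "face_functional \<gamma> u f"
  shows "f (extension z) = norm_deriv u (z \<gamma>)"
proof (cases "sup_norm z = 0")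
  case True
  then have "z \<gamma> = 0" "extension z = 0"
    using norm_le_sup_norm[OF z, of \<gamma>] by (simp_all add: extension_def)
  then show ?thesis
    using f sublinear_zero[OF sublinear_norm_deriv] smooth_pointsD(2)[OF u]
    by (simp add: face_functional_def linear_0)
next
  case False
  then have "f (\<Delta> (\<lambda>\<gamma>. (1 / sup_norm z) *\<^sub>R z \<gamma>)) = norm_deriv u ((1 / sup_norm z) *\<^sub>R z \<gamma>)"
    using face_functional_eq[OF normalized_S[OF z] u f] by simp
  also have "\<dots> = norm_deriv u (z \<gamma>) / sup_norm z"
    using norm_deriv_smooth_linear(2)[OF u Z_X[OF z] Z_X[OF z]] by simp
  finally show ?thesis
    using False f by (simp add: extension_def face_functional_def linear_scale)
qed

text \<open>For a preimage \<open>w\<close> of \<open>y\<close>, vanishing functionals mean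
  vanishing norm derivatives at all smooth points, so every coordinate of \<open>w\<close> is
  0.\<close>

lemma Y_separated:
  assumes y: "y \<in> Y"
    and zero: "\<And>\<gamma> u f. u \<in> smooth_points (X \<gamma>) \<Longrightarrow> face_functional \<gamma> u f \<Longrightarrow> f y = 0"
  shows "y = 0"
proof -
  obtain w where w: "w \<in> Z" "extension w = y" using extension_surj[OF y] by blast
  have "w \<gamma> = 0" for \<gamma>
  proof (rule smooth_points_separate[OF Z_X[OF w(1)]])
    fix u assume u: "u \<in> smooth_points (X \<gamma>)"
    obtain f where f: "face_functional \<gamma> u f"
      using face_functional_exists[OF smooth_pointsD(1,2)[OF u]] by blast
    show "norm_deriv u (w \<gamma>) = 0"
      using face_functional_extension[OF w(1) u f] zero[OF u f] w(2) by simp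
  qed
  then have "sup_norm w = 0" by (simp add: sup_norm_def)
  then show ?thesis using norm_extension[OF w(1)] w(2) by simp
qed

text \<open>Each functional reads off a derivative that is additive on \<open>X \<gamma>\<close>, so
  it annihilates the difference of the two sides.\<close>

lemma extension_add:
  assumes x: "x \<in> Z" and z: "z \<in> Z"
  shows "extension (\<lambda>\<gamma>. x \<gamma> + z \<gamma>) = extension x + extension z"
proof -
  have "extension (\<lambda>\<gamma>. x \<gamma> + z \<gamma>) - (extension x + extension z) = 0"
  proof (rule Y_separated)
    show "extension (\<lambda>\<gamma>. x \<gamma> + z \<gamma>) - (extension x + extension z) \<in> Y"
      using x z subspace_Y by (intro subspace_diff subspace_add extension_Y Z_add)
    fix \<gamma> u f assume uf: "u \<in> smooth_points (X \<gamma>)" "face_functional \<gamma> u f"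
    then have "linear f" by (simp add: face_functional_def)
    then show "f (extension (\<lambda>\<gamma>. x \<gamma> + z \<gamma>) - (extension x + extension z)) = 0"
      using x z face_functional_extension[OF _ uf] norm_deriv_smooth_linear(1)[OF uf(1)]
      by (simp add: linear_diff linear_add Z_add Z_X)
  qed
  then show ?thesis by simp
qed

text \<open>Negative \<open>c\<close> is included because the derivatives at smooth points are
  odd.\<close>

lemma extension_scale:
  assumes z: "z \<in> Z"
  shows "extension (\<lambda>\<gamma>. c *\<^sub>R z \<gamma>) = c *\<^sub>R extension z"
proof -
  have "extension (\<lambda>\<gamma>. c *\<^sub>R z \<gamma>) - c *\<^sub>R extension z = 0"
  proof (rule Y_separated)
    show "extension (\<lambda>\<gamma>. c *\<^sub>R z \<gamma>) - c *\<^sub>R extension z \<in> Y"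
      using z subspace_Y by (intro subspace_diff subspace_scale extension_Y Z_scale)
    fix \<gamma> u f assume uf: "u \<in> smooth_points (X \<gamma>)" "face_functional \<gamma> u f"
    then have "linear f" by (simp add: face_functional_def)
    then show "f (extension (\<lambda>\<gamma>. c *\<^sub>R z \<gamma>) - c *\<^sub>R extension z) = 0"
      using z face_functional_extension[OF _ uf] norm_deriv_smooth_linear(2)[OF uf(1) Z_X[OF z] Z_X[OF z]]
      by (simp add: linear_diff linear_scale Z_scale)
  qed
  then show ?thesis by simp
qed

lemma dist_extension:
  assumes x: "x \<in> Z" and z: "z \<in> Z"
  shows "dist (extension x) (extension z) = sup_norm (\<lambda>\<gamma>. x \<gamma> - z \<gamma>)"
proof -
  have "extension (\<lambda>\<gamma>. x \<gamma> - z \<gamma>) = extension x - extension z"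
    using extension_add[OF x Z_scale[OF z, of "- 1"]] extension_scale[OF z, of "- 1"] by simp
  then show ?thesis using norm_extension[OF Z_diff[OF x z]] by (simp add: dist_norm)
qed

end

section \<open>The Mazur--Ulam property of both sums\<close>

theorem mazur_ulam_propertyI:
  fixes X :: "'i \<Rightarrow> 'a::real_normed_vector set" and Z :: "('i \<Rightarrow> 'a) set"
  assumes "\<exists>\<gamma>1 \<gamma>2::'i. \<gamma>1 \<noteq> \<gamma>2"
    and "\<And>\<gamma>. subspace (X \<gamma>)" "\<And>\<gamma>. strictly_convex_sp (X \<gamma>)" "\<And>\<gamma>. \<exists>e\<in>X \<gamma>. norm e = 1"
    and "\<And>\<gamma>. {x\<in>X \<gamma>. norm x = 1} \<subseteq> closure (smooth_points (X \<gamma>))"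
    and "Z \<subseteq> linf_sum X" "(\<lambda>_. 0) \<in> Z"
    and "\<And>x z. x \<in> Z \<Longrightarrow> z \<in> Z \<Longrightarrow> (\<lambda>\<gamma>. x \<gamma> + z \<gamma>) \<in> Z"
    and "\<And>z c. z \<in> Z \<Longrightarrow> (\<lambda>\<gamma>. c *\<^sub>R z \<gamma>) \<in> Z"
    and "\<And>z \<gamma> a. z \<in> Z \<Longrightarrow> a \<in> X \<gamma> \<Longrightarrow> z(\<gamma> := a) \<in> Z"
  shows "mazur_ulam_property Z TYPE('b::banach)"
  unfolding mazur_ulam_property_def MU_extends_to_def
proof (intro allI impI)
  fix Y :: "'b set" and \<Delta> :: "('i \<Rightarrow> 'a) \<Rightarrow> 'b"
  assume Y: "banach_subspace Y"
    and \<Delta>: "\<Delta> ` {z \<in> Z. sup_norm z = 1} = {y \<in> Y. norm y = 1} \<and>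
      (\<forall>x\<in>{z \<in> Z. sup_norm z = 1}. \<forall>z\<in>{z \<in> Z. sup_norm z = 1}.
        dist (\<Delta> x) (\<Delta> z) = sup_norm (\<lambda>\<gamma>. x \<gamma> - z \<gamma>))"
  interpret sum_sphere_isometry X Z Y \<Delta> "{z \<in> Z. sup_norm z = 1}"
    using assms Y \<Delta> by unfold_locales (auto simp: banach_subspace_def)
  show "\<exists>T. (\<forall>x\<in>Z. \<forall>z\<in>Z. T (\<lambda>\<gamma>. x \<gamma> + z \<gamma>) = T x + T z) \<and>
      (\<forall>c. \<forall>x\<in>Z. T (\<lambda>\<gamma>. c *\<^sub>R x \<gamma>) = c *\<^sub>R T x) \<and> T ` Z = Y \<and>
      (\<forall>x\<in>Z. \<forall>z\<in>Z. dist (T x) (T z) = sup_norm (\<lambda>\<gamma>. x \<gamma> - z \<gamma>)) \<and>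
      (\<forall>x\<in>{z \<in> Z. sup_norm z = 1}. T x = \<Delta> x)"
    using extension_Y extension_surj
    by (intro exI[of _ extension] conjI ballI allI extension_add extension_scale dist_extension
        extension_S) auto
qed

lemma
  assumes X: "\<And>\<gamma>. subspace (X \<gamma>)"
  shows linf_sum_zero: "(\<lambda>_. 0) \<in> linf_sum X"
    and linf_sum_add: "x \<in> linf_sum X \<Longrightarrow> z \<in> linf_sum X \<Longrightarrow> (\<lambda>\<gamma>. x \<gamma> + z \<gamma>) \<in> linf_sum X"
    and linf_sum_scale: "z \<in> linf_sum X \<Longrightarrow> (\<lambda>\<gamma>. c *\<^sub>R z \<gamma>) \<in> linf_sum X"
    and linf_sum_upd: "z \<in> linf_sum X \<Longrightarrow> a \<in> X \<gamma> \<Longrightarrow> z(\<gamma> := a) \<in> linf_sum X"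
proof -
  note bdd = linf_sum_def bdd_above_def
  show "(\<lambda>_. 0) \<in> linf_sum X" using X by (auto simp: bdd subspace_0)
  show "(\<lambda>\<gamma>. x \<gamma> + z \<gamma>) \<in> linf_sum X" if xz: "x \<in> linf_sum X" "z \<in> linf_sum X"
  proof -
    obtain A B where "\<And>\<gamma>. norm (x \<gamma>) \<le> A" "\<And>\<gamma>. norm (z \<gamma>) \<le> B" using xz by (auto simp: bdd)
    then have "norm (x \<gamma> + z \<gamma>) \<le> A + B" for \<gamma> by (intro norm_triangle_mono)
    then show ?thesis using xz X by (auto simp: bdd subspace_add)
  qed
  show "(\<lambda>\<gamma>. c *\<^sub>R z \<gamma>) \<in> linf_sum X" if z: "z \<in> linf_sum X"
  proof -
    obtain B where "\<And>\<gamma>. norm (z \<gamma>) \<le> B" using z by (auto simp: bdd)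
    then have "norm (c *\<^sub>R z \<gamma>) \<le> \<bar>c\<bar> * B" for \<gamma> by (simp add: mult_left_mono)
    then show ?thesis using z X by (auto simp: bdd subspace_scale simp del: norm_scaleR)
  qed
  show "z(\<gamma> := a) \<in> linf_sum X" if z: "z \<in> linf_sum X" "a \<in> X \<gamma>"
  proof -
    obtain B where "\<And>\<gamma>. norm (z \<gamma>) \<le> B" using z by (auto simp: bdd)
    then have "norm ((z(\<gamma> := a)) \<beta>) \<le> max B (norm a)" for \<beta> by (simp add: le_max_iff_disj)
    then have "\<exists>M. \<forall>\<beta>. norm ((z(\<gamma> := a)) \<beta>) \<le> M" by blast
    then show ?thesis using z by (simp add: bdd)
  qed
qed

lemma
  assumes X: "\<And>\<gamma>. subspace (X \<gamma>)"
  shows c0_sum_zero: "(\<lambda>_. 0) \<in> c0_sum X"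
    and c0_sum_add: "x \<in> c0_sum X \<Longrightarrow> z \<in> c0_sum X \<Longrightarrow> (\<lambda>\<gamma>. x \<gamma> + z \<gamma>) \<in> c0_sum X"
    and c0_sum_scale: "z \<in> c0_sum X \<Longrightarrow> (\<lambda>\<gamma>. c *\<^sub>R z \<gamma>) \<in> c0_sum X"
    and c0_sum_upd: "z \<in> c0_sum X \<Longrightarrow> a \<in> X \<gamma> \<Longrightarrow> z(\<gamma> := a) \<in> c0_sum X"
proof -
  show "(\<lambda>_. 0) \<in> c0_sum X" using linf_sum_zero[OF X] by (auto simp: c0_sum_def)
  show "(\<lambda>\<gamma>. x \<gamma> + z \<gamma>) \<in> c0_sum X" if xz: "x \<in> c0_sum X" "z \<in> c0_sum X"
  proof -
    have "finite {\<gamma>. norm (x \<gamma> + z \<gamma>) > e}" if "e > 0" for e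
    proof (rule finite_subset)
      show "{\<gamma>. norm (x \<gamma> + z \<gamma>) > e} \<subseteq> {\<gamma>. norm (x \<gamma>) > e / 2} \<union> {\<gamma>. norm (z \<gamma>) > e / 2}"
        using norm_triangle_lt[of "x _" "z _" e]
        by (auto simp: not_less) (smt (verit) norm_triangle_ineq field_sum_of_halves)
      show "finite ({\<gamma>. norm (x \<gamma>) > e / 2} \<union> {\<gamma>. norm (z \<gamma>) > e / 2})"
        using xz half_gt_zero[OF that] unfolding c0_sum_def by blast
    qed
    then show ?thesis using xz linf_sum_add[OF X] by (auto simp: c0_sum_def)
  qed
  show "(\<lambda>\<gamma>. c *\<^sub>R z \<gamma>) \<in> c0_sum X" if z: "z \<in> c0_sum X"
  proof (cases "c = 0")
    case True
    then show ?thesis using \<open>(\<lambda>_. 0) \<in> c0_sum X\<close> by simp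
  next
    case False
    have "finite {\<gamma>. norm (c *\<^sub>R z \<gamma>) > e}" if "e > 0" for e
    proof -
      have "finite {\<gamma>. norm (z \<gamma>) > e / \<bar>c\<bar>}" using z that False by (simp add: c0_sum_def)
      then show ?thesis using False by (simp add: field_simps)
    qed
    then show ?thesis using z linf_sum_scale[OF X] by (auto simp: c0_sum_def)
  qed
  show "z(\<gamma> := a) \<in> c0_sum X" if z: "z \<in> c0_sum X" "a \<in> X \<gamma>"
  proof -
    have "finite {\<beta>. norm ((z(\<gamma> := a)) \<beta>) > e}" if "e > 0" for e
    proof (rule finite_subset)
      \<comment> \<open>Changing one coordinate adds at most one index.\<close>
      show "{\<beta>. norm ((z(\<gamma> := a)) \<beta>) > e} \<subseteq> insert \<gamma> {\<beta>. norm (z \<beta>) > e}" by auto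
      show "finite (insert \<gamma> {\<beta>. norm (z \<beta>) > e})" using z that by (auto simp: c0_sum_def)
    qed
    then show ?thesis using z linf_sum_upd[OF X] by (auto simp: c0_sum_def)
  qed
qed

theorem theorem3p3:
  fixes X :: "'i \<Rightarrow> 'a::banach set"
  assumes "\<exists>\<gamma>1 \<gamma>2::'i. \<gamma>1 \<noteq> \<gamma>2"
    and "\<And>\<gamma>. banach_subspace (X \<gamma>)"
    and "\<And>\<gamma>. strictly_convex_sp (X \<gamma>)"
    and "\<And>\<gamma>. \<exists>u\<in>X \<gamma>. \<exists>v\<in>X \<gamma>. u \<noteq> v \<and> independent {u, v}"
    and "\<And>\<gamma>. {x\<in>X \<gamma>. norm x = 1} \<subseteq> closure (smooth_points (X \<gamma>))"
  shows "mazur_ulam_property (c0_sum X) TYPE('b::banach) \<and>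
         mazur_ulam_property (linf_sum X) TYPE('b::banach)"
proof -
  have X: "subspace (X \<gamma>)" for \<gamma> using assms(2) by (simp add: banach_subspace_def)
  have unit: "\<exists>e\<in>X \<gamma>. norm e = 1" for \<gamma>
  proof -
    obtain u v where uv: "u \<in> X \<gamma>" "v \<in> X \<gamma>" "independent {u, v}" using assms(4) by blast
    then have "u \<noteq> 0" using dependent_zero by blast
    then show ?thesis
      using uv(1) X by (intro bexI[of _ "(1 / norm u) *\<^sub>R u"]) (auto simp: subspace_scale)
  qed
  note MU = mazur_ulam_propertyI[where X = X, OF assms(1) X assms(3) unit assms(5)]
  show ?thesis
  proof
    have "c0_sum X \<subseteq> linf_sum X" by (auto simp: c0_sum_def)
    then show "mazur_ulam_property (c0_sum X) TYPE('b)"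
      using c0_sum_zero[where X = X, OF X] c0_sum_add[where X = X, OF X]
        c0_sum_scale[where X = X, OF X] c0_sum_upd[where X = X, OF X] by (rule MU)
    show "mazur_ulam_property (linf_sum X) TYPE('b)"
      using order_refl linf_sum_zero[where X = X, OF X] linf_sum_add[where X = X, OF X]
        linf_sum_scale[where X = X, OF X] linf_sum_upd[where X = X, OF X] by (rule MU)
  qed
qed

end
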